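(* Let $R$ be a commutative ring and let $M$ be an $R$-module. Then $M$ is quasi-primeful in each of the following cases: (1) $R$ is a principal ideal domain and $M$ is finitely generated; (2) $R$ is a Dedekind domain and $M$ is faithfully flat; (3) $R$ is Laskerian and $M$ is locally free.
   Context: All rings are commutative with nonzero identity and all modules are unital. For a submodule $N$ of an $R$-module $M$, $(N:M)=\{r\in R\mid rM\subseteq N\}$ and $\mathrm{Ann}(M)=(\mathbf{0}:M)$. A proper ideal $I$ of a ring is quasi-prime if for all ideals $A,B$, $A\cap B\subseteq I$ implies $A\subseteq I$ or $B\subseteq I$. A proper submodule $N$ of $M$ is quasi-prime if $(N:M)$ is a quasi-prime ideal of $R$. $q\mathrm{Spec}(M)$ is the set of all quasi-prime submodules of $M$; $q\mathrm{Spec}(R/\mathrm{Ann}(M))$ is the set of quasi-prime ideals of the ring $R/\mathrm{Ann}(M)$. The natural map is $\psi: q\mathrm{Spec}(M)\to q\mathrm{Spec}(R/\mathrm{Ann}(M))$, $\psi(L)=(L:M)/\mathrm{Ann}(M)$. $M$ is quasi-primeful if either $M=(\mathbf{0})$, or $M\neq(\mathbf{0})$ and its natural map is surjective. A module is Laskerian if every proper submodule has a primary decomposition (is a finite intersection of primary submodules); a ring is Laskerian if it is so as a module over itself. $M$ is locally free if $M_{\mathfrak p}$ is a free $R_{\mathfrak p}$-module for every prime ideal $\mathfrak p$ of $R$. *)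

theory Defs
  imports "HOL-Algebra.Algebra"
begin

text \<open>
  Modules are those of the locale \<open>module\<close> of HOL-Algebra; they are unital, over a commutative ring.
  The fields \<open>mult\<close> and \<open>one\<close> of a module record play no role.
\<close>

section \<open>Quasi-prime submodules and the natural map\<close>

definition residual :: "('a, 'm) ring_scheme \<Rightarrow> ('a, 'b, 'n) module_scheme \<Rightarrow> 'b set \<Rightarrow> 'a set" where
  "residual R M N = {r \<in> carrier R. \<forall>x \<in> carrier M. r \<odot>\<^bsub>M\<^esub> x \<in> N}"

definition annihilator :: "('a, 'm) ring_scheme \<Rightarrow> ('a, 'b, 'n) module_scheme \<Rightarrow> 'a set" where
  "annihilator R M = residual R M {\<zero>\<^bsub>M\<^esub>}"

definition quasi_prime_ideal :: "('a, 'm) ring_scheme \<Rightarrow> 'a set \<Rightarrow> bool" where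
  "quasi_prime_ideal R I \<longleftrightarrow>
     ideal I R \<and> I \<noteq> carrier R \<and>
     (\<forall>A B. ideal A R \<longrightarrow> ideal B R \<longrightarrow> A \<inter> B \<subseteq> I \<longrightarrow> A \<subseteq> I \<or> B \<subseteq> I)"

definition quasi_prime_submodule ::
    "('a, 'm) ring_scheme \<Rightarrow> ('a, 'b, 'n) module_scheme \<Rightarrow> 'b set \<Rightarrow> bool" where
  "quasi_prime_submodule R M N \<longleftrightarrow>
     submodule N R M \<and> N \<noteq> carrier M \<and> quasi_prime_ideal R (residual R M N)"

definition qSpec :: "('a, 'm) ring_scheme \<Rightarrow> ('a, 'b, 'n) module_scheme \<Rightarrow> 'b set set" where
  "qSpec R M = {N. quasi_prime_submodule R M N}"

definition qSpec_ring :: "('a, 'm) ring_scheme \<Rightarrow> 'a set set" where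
  "qSpec_ring R = {I. quasi_prime_ideal R I}"

text \<open>The ideal $(L:M)/\mathrm{Ann}(M)$ as a set of cosets of $\mathrm{Ann}(M)$.\<close>

definition natural_map ::
    "('a, 'm) ring_scheme \<Rightarrow> ('a, 'b, 'n) module_scheme \<Rightarrow> 'b set \<Rightarrow> 'a set set" where
  "natural_map R M L = (\<lambda>r. annihilator R M +>\<^bsub>R\<^esub> r) ` residual R M L"

definition quasi_primeful :: "('a, 'm) ring_scheme \<Rightarrow> ('a, 'b, 'n) module_scheme \<Rightarrow> bool" where
  "quasi_primeful R M \<longleftrightarrow>
     carrier M = {\<zero>\<^bsub>M\<^esub>} \<or>
     (carrier M \<noteq> {\<zero>\<^bsub>M\<^esub>} \<and>
      natural_map R M ` qSpec R M = qSpec_ring (R Quot annihilator R M))"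

section \<open>Finitely generated and free modules\<close>

definition lin_span :: "('a, 'm) ring_scheme \<Rightarrow> ('a, 'b, 'n) module_scheme \<Rightarrow> 'b set \<Rightarrow> 'b set" where
  "lin_span R M B =
     {\<Oplus>\<^bsub>M\<^esub>b\<in>A. c b \<odot>\<^bsub>M\<^esub> b | A c. finite A \<and> A \<subseteq> B \<and> c \<in> A \<rightarrow> carrier R}"

definition fin_generated :: "('a, 'm) ring_scheme \<Rightarrow> ('a, 'b, 'n) module_scheme \<Rightarrow> bool" where
  "fin_generated R M \<longleftrightarrow> (\<exists>B. finite B \<and> B \<subseteq> carrier M \<and> lin_span R M B = carrier M)"

definition lin_independent ::
    "('a, 'm) ring_scheme \<Rightarrow> ('a, 'b, 'n) module_scheme \<Rightarrow> 'b set \<Rightarrow> bool" where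
  "lin_independent R M B \<longleftrightarrow>
     (\<forall>A c. finite A \<longrightarrow> A \<subseteq> B \<longrightarrow> c \<in> A \<rightarrow> carrier R \<longrightarrow>
        (\<Oplus>\<^bsub>M\<^esub>b\<in>A. c b \<odot>\<^bsub>M\<^esub> b) = \<zero>\<^bsub>M\<^esub> \<longrightarrow> (\<forall>b\<in>A. c b = \<zero>\<^bsub>R\<^esub>))"

definition free_module :: "('a, 'm) ring_scheme \<Rightarrow> ('a, 'b, 'n) module_scheme \<Rightarrow> bool" where
  "free_module R M \<longleftrightarrow>
     (\<exists>B. B \<subseteq> carrier M \<and> lin_independent R M B \<and> lin_span R M B = carrier M)"

section \<open>Laskerian modules and rings\<close>

definition self_module :: "('a, 'm) ring_scheme \<Rightarrow> ('a, 'a) module" where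
  "self_module R =
     \<lparr>carrier = carrier R, monoid.mult = monoid.mult R, one = one R, ring.zero = ring.zero R,
      add = add R, smult = monoid.mult R\<rparr>"

definition primary_submodule ::
    "('a, 'm) ring_scheme \<Rightarrow> ('a, 'b, 'n) module_scheme \<Rightarrow> 'b set \<Rightarrow> bool" where
  "primary_submodule R M N \<longleftrightarrow>
     submodule N R M \<and> N \<noteq> carrier M \<and>
     (\<forall>r \<in> carrier R. \<forall>x \<in> carrier M. r \<odot>\<^bsub>M\<^esub> x \<in> N \<longrightarrow>
        x \<in> N \<or> (\<exists>n::nat. r [^]\<^bsub>R\<^esub> n \<in> residual R M N))"

definition has_primary_decomposition ::
    "('a, 'm) ring_scheme \<Rightarrow> ('a, 'b, 'n) module_scheme \<Rightarrow> 'b set \<Rightarrow> bool" where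
  "has_primary_decomposition R M N \<longleftrightarrow>
     (\<exists>\<Q>. finite \<Q> \<and> \<Q> \<noteq> {} \<and> (\<forall>Q\<in>\<Q>. primary_submodule R M Q) \<and> N = \<Inter>\<Q>)"

definition laskerian_module :: "('a, 'm) ring_scheme \<Rightarrow> ('a, 'b, 'n) module_scheme \<Rightarrow> bool" where
  "laskerian_module R M \<longleftrightarrow>
     (\<forall>N. submodule N R M \<and> N \<noteq> carrier M \<longrightarrow> has_primary_decomposition R M N)"

definition laskerian_ring :: "('a, 'm) ring_scheme \<Rightarrow> bool" where
  "laskerian_ring R \<longleftrightarrow> laskerian_module R (self_module R)"

section \<open>Localisation\<close>

text \<open>
  $S^{-1}M$ for a multiplicative set $S$: the fraction $m/s$ is the class of \<open>(m, s)\<close>, and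
  operations on classes are unions over representatives, all of which contribute the same class.
\<close>

definition frac_rel ::
    "('a, 'b, 'n) module_scheme \<Rightarrow> 'a set \<Rightarrow> (('b \<times> 'a) \<times> ('b \<times> 'a)) set" where
  "frac_rel M S =
     {((m, s), (n, t)). m \<in> carrier M \<and> s \<in> S \<and> n \<in> carrier M \<and> t \<in> S \<and>
        (\<exists>u\<in>S. u \<odot>\<^bsub>M\<^esub> (t \<odot>\<^bsub>M\<^esub> m) = u \<odot>\<^bsub>M\<^esub> (s \<odot>\<^bsub>M\<^esub> n))}"

definition fraction :: "('a, 'b, 'n) module_scheme \<Rightarrow> 'a set \<Rightarrow> 'b \<Rightarrow> 'a \<Rightarrow> ('b \<times> 'a) set" where
  "fraction M S m s = frac_rel M S `` {(m, s)}"

definition loc_ring :: "('a, 'm) ring_scheme \<Rightarrow> 'a set \<Rightarrow> ('a \<times> 'a) set ring" where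
  "loc_ring R S =
     \<lparr>carrier = (carrier R \<times> S) // frac_rel (self_module R) S,
      monoid.mult = (\<lambda>p q. \<Union>(a, s)\<in>p. \<Union>(b, t)\<in>q.
               fraction (self_module R) S (a \<otimes>\<^bsub>R\<^esub> b) (s \<otimes>\<^bsub>R\<^esub> t)),
      one = fraction (self_module R) S \<one>\<^bsub>R\<^esub> \<one>\<^bsub>R\<^esub>,
      ring.zero = fraction (self_module R) S \<zero>\<^bsub>R\<^esub> \<one>\<^bsub>R\<^esub>,
      add = (\<lambda>p q. \<Union>(a, s)\<in>p. \<Union>(b, t)\<in>q.
               fraction (self_module R) S (t \<otimes>\<^bsub>R\<^esub> a \<oplus>\<^bsub>R\<^esub> s \<otimes>\<^bsub>R\<^esub> b) (s \<otimes>\<^bsub>R\<^esub> t))\<rparr>"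

definition loc_module ::
    "('a, 'm) ring_scheme \<Rightarrow> 'a set \<Rightarrow> ('a, 'b, 'n) module_scheme \<Rightarrow>
     (('a \<times> 'a) set, ('b \<times> 'a) set) module" where
  "loc_module R S M =
     \<lparr>carrier = (carrier M \<times> S) // frac_rel M S,
      monoid.mult = undefined,
      one = undefined,
      ring.zero = fraction M S \<zero>\<^bsub>M\<^esub> \<one>\<^bsub>R\<^esub>,
      add = (\<lambda>p q. \<Union>(m, s)\<in>p. \<Union>(n, t)\<in>q.
               fraction M S (t \<odot>\<^bsub>M\<^esub> m \<oplus>\<^bsub>M\<^esub> s \<odot>\<^bsub>M\<^esub> n) (s \<otimes>\<^bsub>R\<^esub> t)),
      smult = (\<lambda>p q. \<Union>(a, s)\<in>p. \<Union>(m, t)\<in>q. fraction M S (a \<odot>\<^bsub>M\<^esub> m) (s \<otimes>\<^bsub>R\<^esub> t))\<rparr>"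

definition locally_free :: "('a, 'm) ring_scheme \<Rightarrow> ('a, 'b, 'n) module_scheme \<Rightarrow> bool" where
  "locally_free R M \<longleftrightarrow>
     (\<forall>P. primeideal P R \<longrightarrow>
        free_module (loc_ring R (carrier R - P)) (loc_module R (carrier R - P) M))"

section \<open>Dedekind domains\<close>

definition fraction_field :: "('a, 'm) ring_scheme \<Rightarrow> ('a \<times> 'a) set ring" where
  "fraction_field R = loc_ring R (carrier R - {\<zero>\<^bsub>R\<^esub>})"

definition fraction_embed :: "('a, 'm) ring_scheme \<Rightarrow> 'a \<Rightarrow> ('a \<times> 'a) set" where
  "fraction_embed R a = fraction (self_module R) (carrier R - {\<zero>\<^bsub>R\<^esub>}) a \<one>\<^bsub>R\<^esub>"

text \<open>
  \<open>ring.eval\<close> takes the coefficients of a polynomial in order of decreasing degree, so the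
  list below is a monic polynomial with coefficients in \<open>R\<close>.
\<close>

definition integrally_closed :: "('a, 'm) ring_scheme \<Rightarrow> bool" where
  "integrally_closed R \<longleftrightarrow>
     (\<forall>x \<in> carrier (fraction_field R).
        (\<exists>cs. set cs \<subseteq> carrier R \<and>
           ring.eval (fraction_field R) (\<one>\<^bsub>fraction_field R\<^esub> # map (fraction_embed R) cs) x
             = \<zero>\<^bsub>fraction_field R\<^esub>)
        \<longrightarrow> x \<in> fraction_embed R ` carrier R)"

text \<open>Fields count as Dedekind domains.\<close>

definition dedekind_domain :: "('a, 'm) ring_scheme \<Rightarrow> bool" where
  "dedekind_domain R \<longleftrightarrow>
     noetherian_domain R \<and> integrally_closed R \<and>
     (\<forall>P. primeideal P R \<and> P \<noteq> {\<zero>\<^bsub>R\<^esub>} \<longrightarrow> maximalideal P R)"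

section \<open>Tensor products and faithful flatness\<close>

definition lin_maps ::
    "('a, 'm) ring_scheme \<Rightarrow> ('a, 'b, 'n) module_scheme \<Rightarrow> ('a, 'c, 'k) module_scheme \<Rightarrow>
     ('b \<Rightarrow> 'c) set" where
  "lin_maps R M N =
     {f \<in> carrier M \<rightarrow> carrier N.
        (\<forall>x\<in>carrier M. \<forall>y\<in>carrier M. f (x \<oplus>\<^bsub>M\<^esub> y) = f x \<oplus>\<^bsub>N\<^esub> f y) \<and>
        (\<forall>r\<in>carrier R. \<forall>x\<in>carrier M. f (r \<odot>\<^bsub>M\<^esub> x) = r \<odot>\<^bsub>N\<^esub> f x)}"

definition tensor_relators ::
    "('a, 'm) ring_scheme \<Rightarrow> ('a, 'b, 'n) module_scheme \<Rightarrow> ('a, 'c, 'k) module_scheme \<Rightarrow>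
     ('b \<times> 'c \<Rightarrow>\<^sub>0 int) set" where
  "tensor_relators R M N =
     {frag_of (x \<oplus>\<^bsub>M\<^esub> x', y) - frag_of (x, y) - frag_of (x', y) | x x' y.
        x \<in> carrier M \<and> x' \<in> carrier M \<and> y \<in> carrier N} \<union>
     {frag_of (x, y \<oplus>\<^bsub>N\<^esub> y') - frag_of (x, y) - frag_of (x, y') | x y y'.
        x \<in> carrier M \<and> y \<in> carrier N \<and> y' \<in> carrier N} \<union>
     {frag_of (r \<odot>\<^bsub>M\<^esub> x, y) - frag_of (x, r \<odot>\<^bsub>N\<^esub> y) | r x y.
        r \<in> carrier R \<and> x \<in> carrier M \<and> y \<in> carrier N}"

definition tensor_relations ::
    "('a, 'm) ring_scheme \<Rightarrow> ('a, 'b, 'n) module_scheme \<Rightarrow> ('a, 'c, 'k) module_scheme \<Rightarrow>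
     ('b \<times> 'c \<Rightarrow>\<^sub>0 int) set" where
  "tensor_relations R M N =
     generate (free_Abelian_group (carrier M \<times> carrier N)) (tensor_relators R M N)"

text \<open>
  The abelian group underlying $M \otimes_R N$, written multiplicatively.  Its scalar
  multiplication is not needed, since exactness only concerns the underlying groups.
\<close>

definition tensor ::
    "('a, 'm) ring_scheme \<Rightarrow> ('a, 'b, 'n) module_scheme \<Rightarrow> ('a, 'c, 'k) module_scheme \<Rightarrow>
     ('b \<times> 'c \<Rightarrow>\<^sub>0 int) set monoid" where
  "tensor R M N =
     free_Abelian_group (carrier M \<times> carrier N) Mod tensor_relations R M N"

text \<open>
  The map $\mathrm{id}_M \otimes f : M \otimes N \to M \otimes N'$.  The image of a coset under the
  map $(x, y) \mapsto (x, f(y))$ of free groups lies in a single coset, which is obtained by adding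
  the relations of the target.
\<close>

definition tensor_map ::
    "('a, 'm) ring_scheme \<Rightarrow> ('a, 'b, 'n) module_scheme \<Rightarrow> ('a, 'd, 'l) module_scheme \<Rightarrow>
     ('c \<Rightarrow> 'd) \<Rightarrow> ('b \<times> 'c \<Rightarrow>\<^sub>0 int) set \<Rightarrow> ('b \<times> 'd \<Rightarrow>\<^sub>0 int) set" where
  "tensor_map R M N' f p =
     tensor_relations R M N' <#>\<^bsub>free_Abelian_group (carrier M \<times> carrier N')\<^esub>
       frag_extend (\<lambda>(x, y). frag_of (x, f y)) ` p"

text \<open>
  \<open>M\<close> is faithfully flat if a sequence $N_1 \to N_2 \to N_3$ is exact exactly when
  $M \otimes N_1 \to M \otimes N_2 \to M \otimes N_3$ is.  Since HOL cannot quantify over types, the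
  \<open>N\<^sub>i\<close> have their carriers in the type \<open>'a set\<close>, where \<open>'a\<close> is the type of the
  elements of \<open>R\<close>.  As it contains copies of \<open>R\<close>, its ideals and its cyclic modules, this is
  equivalent to the condition for all modules: flatness may be tested on the inclusions
  \<open>I \<subseteq> R\<close> of ideals, and a flat \<open>M\<close> is faithfully flat as soon as
  $M \otimes R/\mathfrak{m} \neq 0$ for all maximal $\mathfrak{m}$.
\<close>

definition faithfully_flat :: "('a, 'm) ring_scheme \<Rightarrow> ('a, 'b, 'n) module_scheme \<Rightarrow> bool" where
  "faithfully_flat R M \<longleftrightarrow>
     (\<forall>(N\<^sub>1 :: ('a, 'a set) module) (N\<^sub>2 :: ('a, 'a set) module) (N\<^sub>3 :: ('a, 'a set) module) f g.
        module R N\<^sub>1 \<longrightarrow> module R N\<^sub>2 \<longrightarrow> module R N\<^sub>3 \<longrightarrow>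
        f \<in> lin_maps R N\<^sub>1 N\<^sub>2 \<longrightarrow> g \<in> lin_maps R N\<^sub>2 N\<^sub>3 \<longrightarrow>
        (f ` carrier N\<^sub>1 = {y \<in> carrier N\<^sub>2. g y = \<zero>\<^bsub>N\<^sub>3\<^esub>} \<longleftrightarrow>
         tensor_map R M N\<^sub>2 f ` carrier (tensor R M N\<^sub>1)
           = kernel (tensor R M N\<^sub>2) (tensor R M N\<^sub>3) (tensor_map R M N\<^sub>3 g)))"

end

theory Submission
  imports Defs
begin

text \<open>
  In each case a quasi-prime ideal of $R/\mathrm{Ann}(M)$, pulled back to an ideal $I$ of $R$, is
  the image of the submodule $IM$; what has to be shown is that $I$ is quasi-prime in $R$, and that
  $rM \subseteq IM$ implies $r \in I$.  The first is not automatic: it amounts to passing from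
  $A \cap B \subseteq I$ to $(A + \mathrm{Ann}(M)) \cap (B + \mathrm{Ann}(M)) \subseteq I$.

  (1) The ideal lattice of a PID is distributive.  If $I = (c)$, $(r, c) = (g)$ and $c = c'g$, then
  $gM = c'gM$, so by Nakayama $(1 - c't)g \in \mathrm{Ann}(M) \subseteq I$ for some $t$, and hence
  $(g) = I$.

  (2) If $rM \subseteq IM$, then multiplication by $r$ on $R/I$ becomes zero after tensoring with
  $M$, so $R/I \to R/I \to R/I$ (multiplication by $r$, then the identity) becomes exact; hence it
  is exact, which means that $r \in I$.

  (3) Decomposing $I$ shows that it is primary; let $P$ be its radical.  A primary decomposition of
  $0$ shows that $M_P \neq 0$, so that $M_P$ has a basis element, whose coordinate functional gives
  $r/1 \in I_P$ and thus $r \in I$.  The same basis element shows that $\mathrm{Ann}(M)_P = 0$,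
  which makes $I$ quasi-prime.
\<close>

section \<open>Submodules generated by a subset and by an ideal\<close>

text \<open>Both demands on I can fail for a general module. Over the integers, the module of
  rationals has annihilator 0 but pM = M, so no proper submodule has residual (p). In k[x,y]/(x,y)^2
  the ideal K = (x+y) is quasi-prime modulo K, because the quotient by K is a chain ring; yet (x)
  \<inter> (y) = 0 lies in K and neither (x) nor (y) does, so K is not quasi-prime upstairs. The
  second failure is excluded in (2) because the residual bound for I = 0 forces Ann(M) = 0, and in
  (3) because every element of Ann(M) is killed by an element outside P, and such factors can be
  cancelled modulo a P-primary ideal. In (3), M_P \<noteq> 0 does not follow from Ann(M) \<subseteq>
  P alone, as M may be infinitely generated. The finiteness comes from the components of 0: those
  whose radical is in the support intersect inside Ann(M), hence inside P, so the prime P contains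
  one of them together with its radical, and a prime above a support point is in the
  support.\<close>

lemma (in cring) ideal_of_closed:
  assumes "I \<subseteq> carrier R" "\<zero> \<in> I"
    and "\<And>a b. a \<in> I \<Longrightarrow> b \<in> I \<Longrightarrow> a \<oplus> b \<in> I"
    and mult: "\<And>a x. a \<in> I \<Longrightarrow> x \<in> carrier R \<Longrightarrow> x \<otimes> a \<in> I"
  shows "ideal I R"
proof (rule idealI[OF ring_axioms])
  show "subgroup I (add_monoid R)"
  proof (rule add.subgroupI)
    fix a assume "a \<in> I"
    moreover have "\<ominus> a = \<ominus> \<one> \<otimes> a"
      using \<open>a \<in> I\<close> assms(1) by (auto simp: l_minus)
    ultimately show "\<ominus> a \<in> I"
      using mult[of a "\<ominus> \<one>"] by simp
  qed (use assms in auto)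
qed (use assms m_comm in \<open>auto simp: subset_iff\<close>)

lemma (in module) submodule_of_closed:
  assumes "H \<subseteq> carrier M" "\<zero>\<^bsub>M\<^esub> \<in> H"
    and "\<And>x y. x \<in> H \<Longrightarrow> y \<in> H \<Longrightarrow> x \<oplus>\<^bsub>M\<^esub> y \<in> H"
    and smult: "\<And>a x. a \<in> carrier R \<Longrightarrow> x \<in> H \<Longrightarrow> a \<odot>\<^bsub>M\<^esub> x \<in> H"
  shows "submodule H R M"
proof (rule submoduleI)
  fix x assume "x \<in> H"
  moreover have "\<ominus>\<^bsub>M\<^esub> x = (\<ominus> \<one>) \<odot>\<^bsub>M\<^esub> x"
    using \<open>x \<in> H\<close> assms(1) by (auto simp: smult_l_minus)
  ultimately show "\<ominus>\<^bsub>M\<^esub> x \<in> H"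
    using smult[of "\<ominus> \<one>" x] by simp
qed (use assms in auto)

lemma (in module) submodule_zero_closed: "submodule H R M \<Longrightarrow> \<zero>\<^bsub>M\<^esub> \<in> H"
  using subgroup.one_closed[OF submodule.axioms(1)] by fastforce

lemma (in module) finsum_in_submodule:
  assumes "submodule H R M" "f \<in> A \<rightarrow> H"
  shows "(\<Oplus>\<^bsub>M\<^esub>b\<in>A. f b) \<in> H"
proof -
  note H = submoduleE[OF assms(1)] submodule_zero_closed[OF assms(1)]
  show ?thesis
    using assms(2)
  proof (induction A rule: infinite_finite_induct)
    case (insert x F)
    then have "f \<in> F \<rightarrow> carrier M" "f x \<in> carrier M"
      using H(1) by auto
    then have "(\<Oplus>\<^bsub>M\<^esub>b\<in>insert x F. f b) = f x \<oplus>\<^bsub>M\<^esub> (\<Oplus>\<^bsub>M\<^esub>b\<in>F. f b)"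
      using insert.hyps by simp
    then show ?case
      using insert H(5) by auto
  qed (use H in auto)
qed

lemma (in module) lin_span_least:
  assumes "submodule H R M" "B \<subseteq> H"
  shows "lin_span R M B \<subseteq> H"
proof
  fix y assume "y \<in> lin_span R M B"
  then obtain A c where "y = (\<Oplus>\<^bsub>M\<^esub>b\<in>A. c b \<odot>\<^bsub>M\<^esub> b)" "A \<subseteq> B" "c \<in> A \<rightarrow> carrier R"
    unfolding lin_span_def by auto
  moreover have "(\<lambda>b. c b \<odot>\<^bsub>M\<^esub> b) \<in> A \<rightarrow> H"
    using calculation assms submoduleE(4)[OF assms(1)] by blast
  ultimately show "y \<in> H"
    using finsum_in_submodule[OF assms(1)] by simp
qed

lemma (in module) lin_span_superset:
  assumes "B \<subseteq> carrier M"
  shows "B \<subseteq> lin_span R M B"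
proof
  fix b assume "b \<in> B"
  then have "b = (\<Oplus>\<^bsub>M\<^esub>b\<in>{b}. \<one> \<odot>\<^bsub>M\<^esub> b)"
    using assms by (auto simp: M.finsum_insert)
  then show "b \<in> lin_span R M B"
    unfolding lin_span_def using \<open>b \<in> B\<close>
    by (intro CollectI exI[of _ "{b}"] exI[of _ "\<lambda>_. \<one>"]) auto
qed

text \<open>Padding with zero coefficients brings two combinations with different index sets to a
  common one, where they can be added term by term.\<close>

lemma (in module) lin_comb_extend:
  assumes "finite C" "A \<subseteq> C" "C \<subseteq> carrier M" "c \<in> A \<rightarrow> carrier R"
  shows "(\<Oplus>\<^bsub>M\<^esub>b\<in>A. c b \<odot>\<^bsub>M\<^esub> b)
    = (\<Oplus>\<^bsub>M\<^esub>b\<in>C. (if b \<in> A then c b else \<zero>) \<odot>\<^bsub>M\<^esub> b)"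
  by (rule M.add.finprod_mono_neutral_cong_left) (use assms in \<open>auto simp: subset_iff Pi_iff\<close>)

lemma (in module) submodule_lin_span:
  assumes "B \<subseteq> carrier M"
  shows "submodule (lin_span R M B) R M"
proof (rule submodule_of_closed)
  show "lin_span R M B \<subseteq> carrier M"
    using assms by (auto simp: lin_span_def intro!: M.finsum_closed)
  show "\<zero>\<^bsub>M\<^esub> \<in> lin_span R M B"
    by (auto simp: lin_span_def intro!: exI[of _ "{}"])
next
  fix x y assume "x \<in> lin_span R M B" "y \<in> lin_span R M B"
  then obtain A c A' c' where
    A: "x = (\<Oplus>\<^bsub>M\<^esub>b\<in>A. c b \<odot>\<^bsub>M\<^esub> b)" "finite A" "A \<subseteq> B" "c \<in> A \<rightarrow> carrier R" and
    A': "y = (\<Oplus>\<^bsub>M\<^esub>b\<in>A'. c' b \<odot>\<^bsub>M\<^esub> b)" "finite A'" "A' \<subseteq> B" "c' \<in> A' \<rightarrow> carrier R"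
    unfolding lin_span_def by auto
  define d where "d b = (if b \<in> A then c b else \<zero>)" for b
  define d' where "d' b = (if b \<in> A' then c' b else \<zero>)" for b
  have d: "d b \<in> carrier R" "d' b \<in> carrier R" for b
    using A A' by (auto simp: d_def d'_def)
  have AB: "A \<union> A' \<subseteq> carrier M"
    using A A' assms by auto
  have "x = (\<Oplus>\<^bsub>M\<^esub>b\<in>A \<union> A'. d b \<odot>\<^bsub>M\<^esub> b)" "y = (\<Oplus>\<^bsub>M\<^esub>b\<in>A \<union> A'. d' b \<odot>\<^bsub>M\<^esub> b)"
    unfolding A A' d_def d'_def by (rule lin_comb_extend; use A A' AB in auto)+
  then have "x \<oplus>\<^bsub>M\<^esub> y = (\<Oplus>\<^bsub>M\<^esub>b\<in>A \<union> A'. d b \<odot>\<^bsub>M\<^esub> b \<oplus>\<^bsub>M\<^esub> d' b \<odot>\<^bsub>M\<^esub> b)"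
    using d AB by (auto simp: subset_iff intro!: M.finsum_addf[symmetric])
  also have "\<dots> = (\<Oplus>\<^bsub>M\<^esub>b\<in>A \<union> A'. (d b \<oplus> d' b) \<odot>\<^bsub>M\<^esub> b)"
    using d AB by (intro M.finsum_cong') (auto simp: smult_l_distr subset_iff)
  finally show "x \<oplus>\<^bsub>M\<^esub> y \<in> lin_span R M B"
    unfolding lin_span_def using A A' d
    by (intro CollectI exI[of _ "A \<union> A'"] exI[of _ "\<lambda>b. d b \<oplus> d' b"]) auto
next
  fix a x assume a: "a \<in> carrier R" and "x \<in> lin_span R M B"
  then obtain A c where
    A: "x = (\<Oplus>\<^bsub>M\<^esub>b\<in>A. c b \<odot>\<^bsub>M\<^esub> b)" "finite A" "A \<subseteq> B" "c \<in> A \<rightarrow> carrier R"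
    unfolding lin_span_def by auto
  have AM: "b \<in> carrier M" "c b \<in> carrier R" if "b \<in> A" for b
    using that A assms by auto
  have "a \<odot>\<^bsub>M\<^esub> x = (\<Oplus>\<^bsub>M\<^esub>b\<in>A. a \<odot>\<^bsub>M\<^esub> (c b \<odot>\<^bsub>M\<^esub> b))"
    unfolding A by (rule finsum_smult_ldistr) (use A a AM in auto)
  also have "\<dots> = (\<Oplus>\<^bsub>M\<^esub>b\<in>A. (a \<otimes> c b) \<odot>\<^bsub>M\<^esub> b)"
    using AM a by (intro M.finsum_cong') (auto simp: smult_assoc1)
  finally show "a \<odot>\<^bsub>M\<^esub> x \<in> lin_span R M B"
    unfolding lin_span_def using A a
    by (intro CollectI exI[of _ A] exI[of _ "\<lambda>b. a \<otimes> c b"]) auto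
qed

section \<open>The submodule IM\<close>

definition ideal_smult ::
    "('a, 'm) ring_scheme \<Rightarrow> 'a set \<Rightarrow> ('a, 'b, 'n) module_scheme \<Rightarrow> 'b set" where
  "ideal_smult R I M = lin_span R M {a \<odot>\<^bsub>M\<^esub> x | a x. a \<in> I \<and> x \<in> carrier M}"

lemma (in module) submodule_ideal_smult:
  "I \<subseteq> carrier R \<Longrightarrow> submodule (ideal_smult R I M) R M"
  unfolding ideal_smult_def by (rule submodule_lin_span) auto

lemma (in module) ideal_smultI:
  assumes "I \<subseteq> carrier R" "a \<in> I" "x \<in> carrier M"
  shows "a \<odot>\<^bsub>M\<^esub> x \<in> ideal_smult R I M"
  unfolding ideal_smult_def by (rule subsetD[OF lin_span_superset]) (use assms in auto)

text \<open>Every upper bound for IM below goes through this property, so sums of products are never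
  handled: a submodule that contains the products a x is enough.\<close>

lemma (in module) ideal_smult_least:
  assumes "submodule H R M" "\<And>a x. a \<in> I \<Longrightarrow> x \<in> carrier M \<Longrightarrow> a \<odot>\<^bsub>M\<^esub> x \<in> H"
  shows "ideal_smult R I M \<subseteq> H"
  unfolding ideal_smult_def by (rule lin_span_least) (use assms in auto)

section \<open>Residuals, and the passage between R and R/Ann(M)\<close>

lemma (in module) ideal_residual:
  assumes "submodule N R M"
  shows "ideal (residual R M N) R"
  by (rule ideal_of_closed)
    (use submoduleE[OF assms] submodule_zero_closed[OF assms] in
      \<open>auto simp: residual_def smult_l_distr smult_assoc1\<close>)

lemma (in module) submodule_zero: "submodule {\<zero>\<^bsub>M\<^esub>} R M"
  by (rule submodule_of_closed) auto

lemma (in module) ideal_annihilator: "ideal (annihilator R M) R"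
  unfolding annihilator_def by (rule ideal_residual[OF submodule_zero])

lemma (in module) annihilator_subset_residual:
  "submodule N R M \<Longrightarrow> annihilator R M \<subseteq> residual R M N"
  using submodule_zero_closed by (auto simp: annihilator_def residual_def)

lemma (in module) residual_carrier_iff:
  assumes "submodule N R M"
  shows "residual R M N = carrier R \<longleftrightarrow> N = carrier M"
proof
  assume "residual R M N = carrier R"
  then have "\<one> \<in> residual R M N" by simp
  then show "N = carrier M"
    using submoduleE(1)[OF assms] by (auto simp: residual_def)
qed (auto simp: residual_def)

text \<open>A and B are replaced by A + K and B + K, to which \<open>prime\<close> applies. The
  hypothesis \<open>sum\<close> isolates the point at which the ring or the module has to be used:
  distributivity in a principal ideal domain, localisation in the locally free case.\<close>

lemma (in ring) quasi_prime_ideal_lift: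
  assumes "ideal I R" "I \<noteq> carrier R" "ideal K R"
    and prime: "\<And>A B. \<lbrakk>ideal A R; ideal B R; K \<subseteq> A; K \<subseteq> B; A \<inter> B \<subseteq> I\<rbrakk> \<Longrightarrow> A \<subseteq> I \<or> B \<subseteq> I"
    and sum: "\<And>A B. \<lbrakk>ideal A R; ideal B R; A \<inter> B \<subseteq> I\<rbrakk>
      \<Longrightarrow> (A <+>\<^bsub>R\<^esub> K) \<inter> (B <+>\<^bsub>R\<^esub> K) \<subseteq> I"
  shows "quasi_prime_ideal R I"
  unfolding quasi_prime_ideal_def
proof (intro conjI allI impI)
  fix A B assume A: "ideal A R" and B: "ideal B R" and AB: "A \<inter> B \<subseteq> I"
  have sub: "C \<subseteq> C <+>\<^bsub>R\<^esub> K" "K \<subseteq> C <+>\<^bsub>R\<^esub> K" if C: "ideal C R" for C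
  proof -
    have "c = c \<oplus> \<zero>" if "c \<in> C" for c using that ideal.Icarr[OF C] by simp
    moreover have "k = \<zero> \<oplus> k" if "k \<in> K" for k using that ideal.Icarr[OF assms(3)] by simp
    ultimately show "C \<subseteq> C <+>\<^bsub>R\<^esub> K" "K \<subseteq> C <+>\<^bsub>R\<^esub> K"
      unfolding set_add_def'
      using additive_subgroup.zero_closed[OF ideal.axioms(1)] assms(3) C by blast+
  qed
  show "A \<subseteq> I \<or> B \<subseteq> I"
    using prime[of "A <+>\<^bsub>R\<^esub> K" "B <+>\<^bsub>R\<^esub> K"] sum[OF A B AB] add_ideals A B assms(3) sub
    by blast
qed (use assms in auto)

text \<open>The hypotheses on I express, through ideals of R above Ann(M), that I/Ann(M) is
  quasi-prime in the quotient ring. As I \<subseteq> (IM : M) always holds, the two conclusions make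
  IM a quasi-prime submodule which the natural map sends to I/Ann(M).\<close>

lemma (in module) quasi_primefulI:
  assumes main: "\<And>I. \<lbrakk>ideal I R; I \<noteq> carrier R; annihilator R M \<subseteq> I;
      \<And>A B. \<lbrakk>ideal A R; ideal B R; annihilator R M \<subseteq> A; annihilator R M \<subseteq> B; A \<inter> B \<subseteq> I\<rbrakk>
        \<Longrightarrow> A \<subseteq> I \<or> B \<subseteq> I\<rbrakk>
      \<Longrightarrow> quasi_prime_ideal R I \<and> residual R M (ideal_smult R I M) \<subseteq> I"
  shows "quasi_primeful R M"
proof -
  define K where "K = annihilator R M"
  have K: "ideal K R" unfolding K_def by (rule ideal_annihilator)
  have KR: "K \<subseteq> carrier R" using ideal.Icarr[OF K] by blast
  note corr = quot_ideal_correspondence[OF K]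
  have surj: "\<exists>A. J = (+>) K ` A \<and> ideal A R \<and> K \<subseteq> A" if "ideal J (R Quot K)" for J
  proof -
    have "J \<in> (\<lambda>A. (+>) K ` A) ` {A. ideal A R \<and> K \<subseteq> A}"
      using bij_betw_imp_surj_on[OF corr] that by (metis (no_types, lifting) mem_Collect_eq)
    then show ?thesis by (rule imageE) blast
  qed
  \<comment> \<open>The union of the cosets recovers an ideal above K from its image. Hence J
    \<mapsto> J/K reflects inclusions on such ideals (\<open>mono\<close>), which is how statements
    are carried back to R.\<close>
  have inv: "\<Union> ((+>) K ` J) = J" if "ideal J R" "K \<subseteq> J" for J
    using ideal_incl_iff[OF K] that by blast
  have mono: "A \<subseteq> B" if "(+>) K ` A \<subseteq> (+>) K ` B" "ideal A R" "ideal B R" "K \<subseteq> A" "K \<subseteq> B" for A B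
    using that inv Union_mono by metis
  have carr: "(+>) K ` carrier R = carrier (R Quot K)"
    by (auto simp: FactRing_def A_RCOSETS_def')
  have nm: "natural_map R M L = (+>) K ` residual R M L" for L
    by (simp add: natural_map_def K_def)
  \<comment> \<open>Surjectivity is stated as an equality of sets, so the natural map must also be
    shown to land among the quasi-prime ideals of the quotient.\<close>
  have "quasi_prime_ideal (R Quot K) ((+>) K ` I)"
    if qI: "quasi_prime_ideal R I" and KI: "K \<subseteq> I" for I
    unfolding quasi_prime_ideal_def
  proof (intro conjI allI impI)
    have I: "ideal I R" using qI by (simp add: quasi_prime_ideal_def)
    show "ideal ((+>) K ` I) (R Quot K)"
      by (rule ring_ideal_imp_quot_ideal[OF K I])
    show "(+>) K ` I \<noteq> carrier (R Quot K)"
    proof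
      assume "(+>) K ` I = carrier (R Quot K)"
      then have "carrier R \<subseteq> I"
        using mono[OF _ oneideal I KR KI] carr by simp
      then show False
        using qI ideal.Icarr[OF I] by (auto simp: quasi_prime_ideal_def)
    qed
    fix A' B' assume "ideal A' (R Quot K)" "ideal B' (R Quot K)" and AB': "A' \<inter> B' \<subseteq> (+>) K ` I"
    from surj[OF this(1)] surj[OF this(2)]
    obtain A B where A: "A' = (+>) K ` A" "ideal A R" "K \<subseteq> A"
      and B: "B' = (+>) K ` B" "ideal B R" "K \<subseteq> B"
      by auto
    have "(+>) K ` (A \<inter> B) \<subseteq> (+>) K ` I"
      using A B AB' by blast
    then have "A \<inter> B \<subseteq> I"
      by (rule mono) (use A B I KI i_intersect in auto)
    then show "A' \<subseteq> (+>) K ` I \<or> B' \<subseteq> (+>) K ` I"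
      using qI A B unfolding quasi_prime_ideal_def by (meson image_mono)
  qed
  then have "natural_map R M ` qSpec R M \<subseteq> qSpec_ring (R Quot K)"
    using annihilator_subset_residual nm
    by (auto simp: qSpec_def qSpec_ring_def quasi_prime_submodule_def K_def)
  moreover have "J \<in> natural_map R M ` qSpec R M" if "J \<in> qSpec_ring (R Quot K)" for J
  proof -
    have qJ: "quasi_prime_ideal (R Quot K) J"
      using that by (simp add: qSpec_ring_def)
    with surj[of J] obtain I where I: "J = (+>) K ` I" "ideal I R" "K \<subseteq> I"
      unfolding quasi_prime_ideal_def by auto
    have "quasi_prime_ideal R I \<and> residual R M (ideal_smult R I M) \<subseteq> I"
    proof (rule main)
      show "I \<noteq> carrier R"
        using qJ[unfolded quasi_prime_ideal_def] I(1) carr by metis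
      fix A B assume A: "ideal A R" "annihilator R M \<subseteq> A" and B: "ideal B R" "annihilator R M \<subseteq> B"
        and AB: "A \<inter> B \<subseteq> I"
      \<comment> \<open>A and B are unions of cosets of K, so a coset common to both images lies
        inside A \<inter> B, and so does its representative.\<close>
      have "(+>) K ` A \<inter> (+>) K ` B \<subseteq> J"
      proof
        fix Y assume Y: "Y \<in> (+>) K ` A \<inter> (+>) K ` B"
        then have "Y \<subseteq> A \<inter> B"
          using Union_upper[of Y "(+>) K ` A"] Union_upper[of Y "(+>) K ` B"]
            inv[of A] inv[of B] A B K_def by simp
        moreover obtain a where a: "a \<in> A" "Y = K +> a" using Y by auto
        moreover have "a \<in> Y"
          using a ideal.Icarr[OF A(1)] abelian_subgroup.a_rcos_self[OF abelian_subgroupI3[OF ideal.axioms(1)[OF K]]]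
            is_abelian_group by auto
        ultimately show "Y \<in> J"
          using AB I by auto
      qed
      then have "(+>) K ` A \<subseteq> J \<or> (+>) K ` B \<subseteq> J"
        using qJ A B ring_ideal_imp_quot_ideal[OF K] by (simp add: quasi_prime_ideal_def)
      then show "A \<subseteq> I \<or> B \<subseteq> I"
        using mono A B I K_def by metis
    qed (use I K_def in auto)
    moreover have sub: "submodule (ideal_smult R I M) R M"
      using submodule_ideal_smult ideal.Icarr[OF I(2)] by blast
    moreover have "I \<subseteq> residual R M (ideal_smult R I M)"
      using ideal_smultI ideal.Icarr[OF I(2)] by (auto simp: residual_def)
    ultimately have res: "residual R M (ideal_smult R I M) = I" and qI: "quasi_prime_ideal R I"
      by auto
    have "ideal_smult R I M \<noteq> carrier M"
      using residual_carrier_iff[OF sub] res qI by (simp add: quasi_prime_ideal_def)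
    then have "ideal_smult R I M \<in> qSpec R M"
      using sub res qI by (simp add: qSpec_def quasi_prime_submodule_def)
    then show ?thesis
      by (intro image_eqI[of _ _ "ideal_smult R I M"]) (simp_all add: nm res I(1))
  qed
  ultimately show ?thesis
    unfolding quasi_primeful_def K_def by blast
qed

section \<open>Principal ideal domains\<close>

text \<open>Nakayama for N = aN, by removing one generator at a time instead of using determinants.
  The last hypothesis says that B generates N modulo H; it is H being arbitrary that makes the
  induction work, since dropping x from the generators amounts to replacing H by H + Rx.\<close>

lemma (in module) principal_nakayama:
  assumes "finite B" "a \<in> carrier R" "submodule N R M"
    and "\<And>y. y \<in> N \<Longrightarrow> \<exists>z\<in>N. y = a \<odot>\<^bsub>M\<^esub> z"
    and "B \<subseteq> N" "submodule H R M"
    and "\<And>L. \<lbrakk>submodule L R M; H \<subseteq> L; B \<subseteq> L\<rbrakk> \<Longrightarrow> N \<subseteq> L"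
  shows "\<exists>t\<in>carrier R. \<forall>y\<in>N. (\<one> \<ominus> a \<otimes> t) \<odot>\<^bsub>M\<^esub> y \<in> H"
  using assms(1,5-7)
proof (induction B arbitrary: H)
  case empty
  then have "N \<subseteq> H" by auto
  then show ?case
    using assms(2) submoduleE(4)[OF empty.prems(2)] by (intro bexI[of _ \<zero>]) auto
next
  case (insert x B)
  note N = submoduleE(1)[OF assms(3)]
  note H = submoduleE[OF insert.prems(2)] submodule_zero_closed[OF insert.prems(2)]
  define H' where "H' = {h \<oplus>\<^bsub>M\<^esub> c \<odot>\<^bsub>M\<^esub> x | h c. h \<in> H \<and> c \<in> carrier R}"
  have xM: "x \<in> carrier M" using insert.prems N by auto
  have HM: "h \<in> carrier M" if "h \<in> H" for h using that H(1) by auto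
  have H': "submodule H' R M"
  proof (rule submodule_of_closed)
    show "H' \<subseteq> carrier M" using xM HM by (auto simp: H'_def)
    show "\<zero>\<^bsub>M\<^esub> \<in> H'"
      unfolding H'_def using H(7) xM by (auto intro!: exI[of _ "\<zero>\<^bsub>M\<^esub>"] exI[of _ \<zero>])
    fix y z assume "y \<in> H'" "z \<in> H'"
    then obtain h c h' c' where "h \<in> H" "c \<in> carrier R" "h' \<in> H" "c' \<in> carrier R"
      "y = h \<oplus>\<^bsub>M\<^esub> c \<odot>\<^bsub>M\<^esub> x" "z = h' \<oplus>\<^bsub>M\<^esub> c' \<odot>\<^bsub>M\<^esub> x"
      by (auto simp: H'_def)
    moreover from this have "y \<oplus>\<^bsub>M\<^esub> z = (h \<oplus>\<^bsub>M\<^esub> h') \<oplus>\<^bsub>M\<^esub> (c \<oplus> c') \<odot>\<^bsub>M\<^esub> x"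
      using xM HM by (simp add: smult_l_distr M.a_ac)
    ultimately show "y \<oplus>\<^bsub>M\<^esub> z \<in> H'"
      unfolding H'_def using H(5) by blast
  next
    fix d y assume d: "d \<in> carrier R" and "y \<in> H'"
    then obtain h c where "h \<in> H" "c \<in> carrier R" "y = h \<oplus>\<^bsub>M\<^esub> c \<odot>\<^bsub>M\<^esub> x"
      by (auto simp: H'_def)
    moreover from this have "d \<odot>\<^bsub>M\<^esub> y = d \<odot>\<^bsub>M\<^esub> h \<oplus>\<^bsub>M\<^esub> (d \<otimes> c) \<odot>\<^bsub>M\<^esub> x"
      using xM HM d by (simp add: smult_r_distr smult_assoc1)
    ultimately show "d \<odot>\<^bsub>M\<^esub> y \<in> H'"
      unfolding H'_def using H(4) d by blast
  qed
  have HH': "H \<subseteq> H'"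
  proof
    fix h assume "h \<in> H"
    then have "h = h \<oplus>\<^bsub>M\<^esub> \<zero> \<odot>\<^bsub>M\<^esub> x" using xM HM by simp
    then show "h \<in> H'" unfolding H'_def using \<open>h \<in> H\<close> by blast
  qed
  have "x = \<zero>\<^bsub>M\<^esub> \<oplus>\<^bsub>M\<^esub> \<one> \<odot>\<^bsub>M\<^esub> x" using xM by simp
  then have xH': "x \<in> H'"
    unfolding H'_def using H(7) by blast
  have "\<exists>t\<in>carrier R. \<forall>y\<in>N. (\<one> \<ominus> a \<otimes> t) \<odot>\<^bsub>M\<^esub> y \<in> H'"
  proof (rule insert.IH)
    fix L assume L: "submodule L R M" "H' \<subseteq> L" "B \<subseteq> L"
    show "N \<subseteq> L"
      by (rule insert.prems(3)) (use L HH' xH' in auto)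
  qed (use insert.prems H' in auto)
  then obtain t where t: "t \<in> carrier R" "\<And>y. y \<in> N \<Longrightarrow> (\<one> \<ominus> a \<otimes> t) \<odot>\<^bsub>M\<^esub> y \<in> H'"
    by blast
  define u where "u = \<one> \<ominus> a \<otimes> t"
  have u: "u \<in> carrier R" using t assms(2) by (simp add: u_def)
  \<comment> \<open>With x = a z and u z = h + c x one gets u x = a h + (a c) x, so v = u - a c
    moves x into H.\<close>
  obtain z where z: "z \<in> N" "x = a \<odot>\<^bsub>M\<^esub> z" using assms(4) insert.prems by blast
  obtain h c where h: "h \<in> H" "c \<in> carrier R" "u \<odot>\<^bsub>M\<^esub> z = h \<oplus>\<^bsub>M\<^esub> c \<odot>\<^bsub>M\<^esub> x"
    using t(2)[OF z(1)] by (auto simp: H'_def u_def)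
  define v where "v = u \<ominus> a \<otimes> c"
  have v: "v \<in> carrier R" using u assms(2) h by (simp add: v_def)
  have zM: "z \<in> carrier M" using z N by auto
  have "u \<odot>\<^bsub>M\<^esub> x = a \<odot>\<^bsub>M\<^esub> (u \<odot>\<^bsub>M\<^esub> z)"
    using zM u assms(2) by (simp add: z(2) smult_assoc1[symmetric] m_comm)
  also have "\<dots> = a \<odot>\<^bsub>M\<^esub> h \<oplus>\<^bsub>M\<^esub> (a \<otimes> c) \<odot>\<^bsub>M\<^esub> x"
    using h HM xM assms(2) by (simp add: smult_r_distr smult_assoc1)
  finally have ux: "u \<odot>\<^bsub>M\<^esub> x = a \<odot>\<^bsub>M\<^esub> h \<oplus>\<^bsub>M\<^esub> (a \<otimes> c) \<odot>\<^bsub>M\<^esub> x" .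
  have "v \<odot>\<^bsub>M\<^esub> x = u \<odot>\<^bsub>M\<^esub> x \<oplus>\<^bsub>M\<^esub> \<ominus>\<^bsub>M\<^esub> ((a \<otimes> c) \<odot>\<^bsub>M\<^esub> x)"
    using u h xM assms(2) by (simp add: v_def R.minus_eq smult_l_distr smult_l_minus)
  also have "\<dots> = a \<odot>\<^bsub>M\<^esub> h"
    using h HM xM assms(2) by (simp add: ux M.a_assoc M.r_neg)
  finally have vx: "v \<odot>\<^bsub>M\<^esub> x \<in> H"
    using H(4) h assms(2) by simp
  \<comment> \<open>Read off from (1 - a t - a c)(1 - a t) = 1 - a s.\<close>
  define s where "s = t \<oplus> t \<oplus> c \<ominus> a \<otimes> t \<otimes> (t \<oplus> c)"
  have s: "s \<in> carrier R" using t h assms(2) by (simp add: s_def)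
  have vu: "v \<otimes> u = \<one> \<ominus> a \<otimes> s"
    unfolding v_def u_def s_def using t(1) h(2) assms(2) by algebra
  \<comment> \<open>u carries N into H + Rx, and v carries H as well as x into H.\<close>
  have "(\<one> \<ominus> a \<otimes> s) \<odot>\<^bsub>M\<^esub> y \<in> H" if y: "y \<in> N" for y
  proof -
    have yM: "y \<in> carrier M" using y N by auto
    obtain k d where k: "k \<in> H" "d \<in> carrier R" "u \<odot>\<^bsub>M\<^esub> y = k \<oplus>\<^bsub>M\<^esub> d \<odot>\<^bsub>M\<^esub> x"
      using t(2)[OF y] by (auto simp: H'_def u_def)
    have "(v \<otimes> u) \<odot>\<^bsub>M\<^esub> y = v \<odot>\<^bsub>M\<^esub> k \<oplus>\<^bsub>M\<^esub> d \<odot>\<^bsub>M\<^esub> (v \<odot>\<^bsub>M\<^esub> x)"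
      using u v yM k HM xM by (simp add: smult_assoc1 k(3) smult_r_distr)
        (simp add: smult_assoc1[symmetric] m_comm)
    also have "\<dots> \<in> H"
      using H(4,5) vx k v by simp
    finally show ?thesis by (simp add: vu)
  qed
  then show ?case using s by blast
qed

text \<open>Bezout: let e be a gcd of the generators a = a' e and b = b' e, so that u a' + v b' = 1.
  Then x = u a' x + v b' x, and each half is a multiple of the lcm a' b' e up to an element of
  K.\<close>

lemma (in principal_domain) distrib_ideals:
  assumes "ideal A R" "ideal B R" "ideal K R"
  shows "(A <+>\<^bsub>R\<^esub> K) \<inter> (B <+>\<^bsub>R\<^esub> K) \<subseteq> (A \<inter> B) <+>\<^bsub>R\<^esub> K"
proof
  fix x assume "x \<in> (A <+>\<^bsub>R\<^esub> K) \<inter> (B <+>\<^bsub>R\<^esub> K)"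
  then obtain a0 k b0 k' where x: "a0 \<in> A" "k \<in> K" "x = a0 \<oplus> k" "b0 \<in> B" "k' \<in> K" "x = b0 \<oplus> k'"
    by (auto simp: set_add_def')
  obtain a where a: "a \<in> carrier R" "A = PIdl a"
    using exists_gen[OF assms(1)] by blast
  obtain b where b: "b \<in> carrier R" "B = PIdl b"
    using exists_gen[OF assms(2)] by blast
  obtain e where e: "e \<in> carrier R" "A <+>\<^bsub>R\<^esub> B = PIdl e"
    using exists_gen[OF add_ideals[OF assms(1,2)]] by blast
  note carr = ideal.Icarr[OF assms(1)] ideal.Icarr[OF assms(2)] ideal.Icarr[OF assms(3)]
  have "a \<oplus> \<zero> \<in> PIdl e" "\<zero> \<oplus> b \<in> PIdl e"
    unfolding e(2)[symmetric] set_add_def'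
    using cgenideal_self[OF a(1)] cgenideal_self[OF b(1)]
      additive_subgroup.zero_closed[OF ideal.axioms(1)] assms(1,2) by (auto simp: a(2) b(2))
  then obtain a' b' where a': "a' \<in> carrier R" "a = a' \<otimes> e" and b': "b' \<in> carrier R" "b = b' \<otimes> e"
    using a(1) b(1) by (auto simp: cgenideal_def)
  obtain p q where pq: "p \<in> carrier R" "q \<in> carrier R" "a0 = p \<otimes> a" "b0 = q \<otimes> b"
    using x a b by (auto simp: cgenideal_def)
  obtain u v where uv: "u \<in> carrier R" "v \<in> carrier R" "e = u \<otimes> a \<oplus> v \<otimes> b"
    using cgenideal_self[OF e(1)] unfolding e(2)[symmetric] a(2) b(2)
    by (auto simp: set_add_def' cgenideal_def)
  show "x \<in> (A \<inter> B) <+>\<^bsub>R\<^esub> K"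
  \<comment> \<open>For e = 0 nothing can be cancelled, but then A and B vanish and x = k.\<close>
  proof (cases "e = \<zero>")
    case True
    then have "a0 = \<zero>" "b0 = \<zero>" using pq a' b' by auto
    then show ?thesis
      using x assms additive_subgroup.zero_closed[OF ideal.axioms(1)]
      by (auto simp: set_add_def')
  next
    case False
    have "(u \<otimes> a' \<oplus> v \<otimes> b') \<otimes> e = \<one> \<otimes> e"
      using uv(3) uv(1,2) a' b' e(1) by (simp add: l_distr m_assoc)
    then have one: "u \<otimes> a' \<oplus> v \<otimes> b' = \<one>"
      using m_rcancel[OF False e(1)] uv(1,2) a' b' by simp
    define y where "y = (u \<otimes> q \<oplus> v \<otimes> p) \<otimes> (a' \<otimes> b' \<otimes> e)"
    define z where "z = (u \<otimes> a') \<otimes> k' \<oplus> (v \<otimes> b') \<otimes> k"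
    have kc: "k \<in> carrier R" "k' \<in> carrier R" using x carr by auto
    have "x = (u \<otimes> a' \<oplus> v \<otimes> b') \<otimes> x"
      using one x kc carr by simp
    also have "\<dots> = (u \<otimes> a') \<otimes> x \<oplus> (v \<otimes> b') \<otimes> x"
      using x(1,3) kc carr uv a' b' by (simp add: l_distr)
    \<comment> \<open>The two representations of x are used crosswise: the half with factor a'
      receives the one through B, the half with factor b' the one through A.\<close>
    also have "\<dots> = (u \<otimes> a') \<otimes> (q \<otimes> (b' \<otimes> e) \<oplus> k') \<oplus> (v \<otimes> b') \<otimes> (p \<otimes> (a' \<otimes> e) \<oplus> k)"
      using x(3,6) pq a' b' by metis
    also have "\<dots> = y \<oplus> z"
      unfolding y_def z_def using uv(1,2) pq(1,2) a'(1) b'(1) e(1) kc by algebra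
    finally have "x = y \<oplus> z" .
    moreover have "y \<in> A"
    proof -
      have "y = ((u \<otimes> q \<oplus> v \<otimes> p) \<otimes> b') \<otimes> a"
        unfolding y_def a' using uv(1,2) pq(1,2) a'(1) b'(1) e(1) by algebra
      then show ?thesis using uv(1,2) pq(1,2) b'(1) a by (auto simp: cgenideal_def)
    qed
    moreover have "y \<in> B"
    proof -
      have "y = ((u \<otimes> q \<oplus> v \<otimes> p) \<otimes> a') \<otimes> b"
        unfolding y_def b' using uv(1,2) pq(1,2) a'(1) b'(1) e(1) by algebra
      then show ?thesis using uv(1,2) pq(1,2) a'(1) b by (auto simp: cgenideal_def)
    qed
    moreover have "z \<in> K"
      unfolding z_def using x uv(1,2) a'(1) b'(1) ideal.I_l_closed[OF assms(3)]
        additive_subgroup.a_closed[OF ideal.axioms(1)[OF assms(3)]] by simp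
    ultimately show ?thesis
      by (auto simp: set_add_def')
  qed
qed

lemma (in module) residual_ideal_smult_principal:
  assumes "principal_domain R" "fin_generated R M" "ideal I R" "annihilator R M \<subseteq> I"
  shows "residual R M (ideal_smult R I M) \<subseteq> I"
proof
  interpret P: principal_domain R by fact
  fix r assume "r \<in> residual R M (ideal_smult R I M)"
  then have r: "r \<in> carrier R" "\<And>x. x \<in> carrier M \<Longrightarrow> r \<odot>\<^bsub>M\<^esub> x \<in> ideal_smult R I M"
    by (auto simp: residual_def)
  obtain c where c: "c \<in> carrier R" "I = PIdl c"
    using P.exists_gen[OF assms(3)] by blast
  have img: "submodule ((\<odot>\<^bsub>M\<^esub>) d ` carrier M) R M" if d: "d \<in> carrier R" for d
  proof (rule submodule_of_closed)
    show "\<zero>\<^bsub>M\<^esub> \<in> (\<odot>\<^bsub>M\<^esub>) d ` carrier M"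
      using d by (intro image_eqI[of _ _ "\<zero>\<^bsub>M\<^esub>"]) auto
  next
    fix a x assume "a \<in> carrier R" "x \<in> (\<odot>\<^bsub>M\<^esub>) d ` carrier M"
    then obtain y where "y \<in> carrier M" "x = d \<odot>\<^bsub>M\<^esub> y" by auto
    then show "a \<odot>\<^bsub>M\<^esub> x \<in> (\<odot>\<^bsub>M\<^esub>) d ` carrier M"
      using \<open>a \<in> carrier R\<close> d
      by (intro image_eqI[of _ _ "a \<odot>\<^bsub>M\<^esub> y"]) (simp_all add: smult_assoc1[symmetric] m_comm)
  qed (use d in \<open>auto simp flip: smult_r_distr\<close>)
  \<comment> \<open>For I = (c) the multiples c x already form a submodule, so membership of r x in
    IM yields a single z with r x = c z.\<close>
  have "ideal_smult R I M \<subseteq> (\<odot>\<^bsub>M\<^esub>) c ` carrier M"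
  proof (rule ideal_smult_least[OF img[OF c(1)]])
    fix a x assume "a \<in> I" "x \<in> carrier M"
    then obtain a' where "a' \<in> carrier R" "a = a' \<otimes> c" using c by (auto simp: cgenideal_def)
    then show "a \<odot>\<^bsub>M\<^esub> x \<in> (\<odot>\<^bsub>M\<^esub>) c ` carrier M"
      using c \<open>x \<in> carrier M\<close>
      by (intro image_eqI[of _ _ "a' \<odot>\<^bsub>M\<^esub> x"]) (simp_all add: smult_assoc1[symmetric] m_comm)
  qed
  then have rc: "\<exists>z\<in>carrier M. r \<odot>\<^bsub>M\<^esub> x = c \<odot>\<^bsub>M\<^esub> z" if "x \<in> carrier M" for x
    using r(2)[OF that] by blast
  obtain g where g: "g \<in> carrier R" "PIdl r <+>\<^bsub>R\<^esub> PIdl c = PIdl g"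
    using P.exists_gen[OF add_ideals[OF cgenideal_ideal[OF r(1)] cgenideal_ideal[OF c(1)]]] by blast
  have "r \<oplus> \<zero> \<otimes> c \<in> PIdl r <+>\<^bsub>R\<^esub> PIdl c" "\<zero> \<otimes> r \<oplus> c \<in> PIdl r <+>\<^bsub>R\<^esub> PIdl c"
    unfolding set_add_def' using cgenideal_self[OF r(1)] cgenideal_self[OF c(1)]
    by (auto simp: cgenideal_def)
  then obtain r' c' where r': "r' \<in> carrier R" "r = r' \<otimes> g" and c': "c' \<in> carrier R" "c = c' \<otimes> g"
    using r(1) c(1) unfolding g(2) by (auto simp: cgenideal_def)
  obtain p q where pq: "p \<in> carrier R" "q \<in> carrier R" "g = p \<otimes> r \<oplus> q \<otimes> c"
    using cgenideal_self[OF g(1)] unfolding g(2)[symmetric]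
    by (auto simp: set_add_def' cgenideal_def)
  obtain B where B: "finite B" "B \<subseteq> carrier M" "lin_span R M B = carrier M"
    using assms(2) by (auto simp: fin_generated_def)
  define N where "N = (\<odot>\<^bsub>M\<^esub>) g ` carrier M"
  \<comment> \<open>Nakayama for N = gM with H = 0: from r x = c z follows g x = p r x + q c x = c
    (p z + q x) = c' g (p z + q x), so N \<subseteq> c' N.\<close>
  have "\<exists>t\<in>carrier R. \<forall>y\<in>N. (\<one> \<ominus> c' \<otimes> t) \<odot>\<^bsub>M\<^esub> y \<in> {\<zero>\<^bsub>M\<^esub>}"
  proof (rule principal_nakayama[of "(\<odot>\<^bsub>M\<^esub>) g ` B"])
    show "submodule N R M" unfolding N_def by (rule img[OF g(1)])
    fix y assume "y \<in> N"
    then obtain x where x: "x \<in> carrier M" "y = g \<odot>\<^bsub>M\<^esub> x" by (auto simp: N_def)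
    obtain z where z: "z \<in> carrier M" "r \<odot>\<^bsub>M\<^esub> x = c \<odot>\<^bsub>M\<^esub> z" using rc[OF x(1)] by blast
    have "y = p \<odot>\<^bsub>M\<^esub> (r \<odot>\<^bsub>M\<^esub> x) \<oplus>\<^bsub>M\<^esub> (q \<otimes> c) \<odot>\<^bsub>M\<^esub> x"
      unfolding x(2) pq(3) using pq(1,2) r(1) c(1) x(1) by (simp add: smult_l_distr smult_assoc1)
    also have "\<dots> = c \<odot>\<^bsub>M\<^esub> (p \<odot>\<^bsub>M\<^esub> z \<oplus>\<^bsub>M\<^esub> q \<odot>\<^bsub>M\<^esub> x)"
      unfolding z(2) using pq(1,2) c(1) x(1) z(1)
      by (simp add: smult_r_distr smult_assoc1[symmetric] m_comm)
    also have "\<dots> = c' \<odot>\<^bsub>M\<^esub> (g \<odot>\<^bsub>M\<^esub> (p \<odot>\<^bsub>M\<^esub> z \<oplus>\<^bsub>M\<^esub> q \<odot>\<^bsub>M\<^esub> x))"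
      unfolding c'(2) using pq(1,2) c'(1) g(1) x(1) z(1) by (simp add: smult_assoc1)
    finally show "\<exists>z\<in>N. y = c' \<odot>\<^bsub>M\<^esub> z"
      using pq(1,2) x(1) z(1) by (auto simp: N_def)
  next
    fix L assume L: "submodule L R M" "(\<odot>\<^bsub>M\<^esub>) g ` B \<subseteq> L"
    \<comment> \<open>The preimage of L under multiplication by g contains B, hence is M; in this
      sense gB generates gM.\<close>
    have "submodule {x \<in> carrier M. g \<odot>\<^bsub>M\<^esub> x \<in> L} R M"
    proof (rule submodule_of_closed)
      fix a x assume a: "a \<in> carrier R" and x: "x \<in> {x \<in> carrier M. g \<odot>\<^bsub>M\<^esub> x \<in> L}"
      have "g \<odot>\<^bsub>M\<^esub> (a \<odot>\<^bsub>M\<^esub> x) = a \<odot>\<^bsub>M\<^esub> (g \<odot>\<^bsub>M\<^esub> x)"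
        using a x g(1) by (simp add: smult_assoc1[symmetric] m_comm)
      then show "a \<odot>\<^bsub>M\<^esub> x \<in> {x \<in> carrier M. g \<odot>\<^bsub>M\<^esub> x \<in> L}"
        using a x submoduleE(4)[OF L(1)] by simp
    qed (use g(1) submodule_zero_closed[OF L(1)] submoduleE(5)[OF L(1)] in \<open>auto simp: smult_r_distr\<close>)
    then have "lin_span R M B \<subseteq> {x \<in> carrier M. g \<odot>\<^bsub>M\<^esub> x \<in> L}"
      by (rule lin_span_least) (use L(2) B(2) in auto)
    then show "N \<subseteq> L" unfolding B(3) N_def by auto
  qed (use B c' submodule_zero in \<open>auto simp: N_def\<close>)
  then obtain t where t: "t \<in> carrier R"
    "\<And>x. x \<in> carrier M \<Longrightarrow> (\<one> \<ominus> c' \<otimes> t) \<odot>\<^bsub>M\<^esub> (g \<odot>\<^bsub>M\<^esub> x) = \<zero>\<^bsub>M\<^esub>"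
    by (auto simp: N_def)
  then have "(\<one> \<ominus> c' \<otimes> t) \<otimes> g \<in> annihilator R M"
    using c'(1) g(1) by (simp add: annihilator_def residual_def smult_assoc1)
  then obtain d where d: "d \<in> carrier R" "(\<one> \<ominus> c' \<otimes> t) \<otimes> g = d \<otimes> c"
    using assms(4) c by (auto simp: cgenideal_def)
  \<comment> \<open>Solves (1 - c' t) g = d c = d c' g for g. The right-hand side is (t + d) c, so
    g, and with it r, is a multiple of c.\<close>
  have "g = c' \<otimes> (t \<oplus> d) \<otimes> g"
  proof -
    have "c' \<otimes> (t \<oplus> d) \<otimes> g = c' \<otimes> t \<otimes> g \<oplus> d \<otimes> (c' \<otimes> g)"
      using c'(1) t(1) d(1) g(1) by algebra
    also have "\<dots> = c' \<otimes> t \<otimes> g \<oplus> (\<one> \<ominus> c' \<otimes> t) \<otimes> g"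
      by (simp add: d(2) flip: c'(2))
    also have "\<dots> = g"
      using c'(1) t(1) g(1) by algebra
    finally show ?thesis by simp
  qed
  then have "r = r' \<otimes> (c' \<otimes> (t \<oplus> d) \<otimes> g)"
    using r'(2) by simp
  also have "\<dots> = (r' \<otimes> (t \<oplus> d)) \<otimes> c"
    unfolding c'(2) using r'(1) c'(1) t(1) d(1) g(1) by algebra
  finally show "r \<in> I"
    using r'(1) t(1) d(1) by (auto simp: c(2) cgenideal_def)
qed

lemma (in module) quasi_primeful_principal:
  assumes "principal_domain R" "fin_generated R M"
  shows "quasi_primeful R M"
proof (rule quasi_primefulI, rule conjI)
  interpret P: principal_domain R by fact
  fix I
  let ?K = "annihilator R M"
  assume I: "ideal I R" "I \<noteq> carrier R" "?K \<subseteq> I"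
    and prime: "\<And>A B. \<lbrakk>ideal A R; ideal B R; ?K \<subseteq> A; ?K \<subseteq> B; A \<inter> B \<subseteq> I\<rbrakk> \<Longrightarrow> A \<subseteq> I \<or> B \<subseteq> I"
  show "quasi_prime_ideal R I"
  proof (rule quasi_prime_ideal_lift[OF I(1,2) ideal_annihilator prime])
    fix A B assume A: "ideal A R" and B: "ideal B R" and AB: "A \<inter> B \<subseteq> I"
    have "(A <+>\<^bsub>R\<^esub> ?K) \<inter> (B <+>\<^bsub>R\<^esub> ?K) \<subseteq> (A \<inter> B) <+>\<^bsub>R\<^esub> ?K"
      by (rule P.distrib_ideals[OF A B ideal_annihilator])
    also have "\<dots> \<subseteq> I"
      using AB I(3) additive_subgroup.a_closed[OF ideal.axioms(1)[OF I(1)]]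
      by (auto simp: set_add_def')
    finally show "(A <+>\<^bsub>R\<^esub> ?K) \<inter> (B <+>\<^bsub>R\<^esub> ?K) \<subseteq> I" .
  qed
qed (rule residual_ideal_smult_principal[OF assms])

section \<open>Faithfully flat modules\<close>

text \<open>R/I as an R-module, each scalar acting through its coset. The elements are cosets, of
  type \<open>'a set\<close>, which is the type that \<open>faithfully_flat\<close> quantifies over,
  so R/I is available as a test module.\<close>

definition quot_module :: "('a, 'm) ring_scheme \<Rightarrow> 'a set \<Rightarrow> ('a, 'a set) module" where
  "quot_module R I =
     \<lparr>carrier = a_rcosets\<^bsub>R\<^esub> I, monoid.mult = rcoset_mult R I, one = I +>\<^bsub>R\<^esub> \<one>\<^bsub>R\<^esub>,
      ring.zero = I, add = set_add R, smult = (\<lambda>r. rcoset_mult R I (I +>\<^bsub>R\<^esub> r))\<rparr>"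

lemma (in cring) carrier_quot_module:
  "carrier (quot_module R I) = {I +> r | r. r \<in> carrier R}"
  by (auto simp: quot_module_def A_RCOSETS_def')

lemma (in cring) smult_quot_module:
  "\<lbrakk>ideal I R; r \<in> carrier R; s \<in> carrier R\<rbrakk> \<Longrightarrow> r \<odot>\<^bsub>quot_module R I\<^esub> (I +> s) = I +> (r \<otimes> s)"
  by (simp add: quot_module_def ideal.rcoset_mult_add)

lemma (in cring) add_quot_module:
  "\<lbrakk>ideal I R; r \<in> carrier R; s \<in> carrier R\<rbrakk> \<Longrightarrow>
    (I +> r) \<oplus>\<^bsub>quot_module R I\<^esub> (I +> s) = I +> (r \<oplus> s)"
  by (simp add: quot_module_def ideal.a_rcos_sum)

lemma (in cring) zero_quot_module: "\<zero>\<^bsub>quot_module R I\<^esub> = I"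
  by (simp add: quot_module_def)

lemma (in cring) module_quot_module:
  assumes I: "ideal I R"
  shows "module R (quot_module R I)"
proof (rule moduleI)
  interpret ideal I R by fact
  interpret Q: ring "R Quot I" by (rule quotient_is_ring)
  have eq: "carrier (quot_module R I) = carrier (R Quot I)" "add (quot_module R I) = add (R Quot I)"
    "\<zero>\<^bsub>quot_module R I\<^esub> = \<zero>\<^bsub>R Quot I\<^esub>"
    by (simp_all add: quot_module_def FactRing_def)
  show "abelian_group (quot_module R I)"
    by (rule abelian_groupI) (auto simp: eq Q.a_ac intro: Q.l_neg Q.a_inv_closed)
  show "cring R" by (rule is_cring)
qed (auto simp: carrier_quot_module smult_quot_module add_quot_module I l_distr r_distr m_assoc)

section \<open>Vanishing pure tensors and induced maps\<close>

lemma generate_free_Abelian_group_closed: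
  assumes "H = generate (free_Abelian_group S) T" "T \<subseteq> carrier (free_Abelian_group S)"
  shows "subgroup H (free_Abelian_group S)" "T \<subseteq> H" "0 \<in> H"
    and "\<And>x y. x \<in> H \<Longrightarrow> y \<in> H \<Longrightarrow> x + y \<in> H"
    and "\<And>x y. x \<in> H \<Longrightarrow> y \<in> H \<Longrightarrow> x - y \<in> H"
proof -
  show H: "subgroup H (free_Abelian_group S)"
    unfolding assms(1) by (rule group.generate_is_subgroup[OF group_free_Abelian_group assms(2)])
  show "T \<subseteq> H" unfolding assms(1) by (auto intro: generate.incl)
  show "0 \<in> H" using subgroup.one_closed[OF H] by simp
  show add: "x + y \<in> H" if "x \<in> H" "y \<in> H" for x y
    using subgroup.m_closed[OF H that] by simp
  show "x - y \<in> H" if "x \<in> H" "y \<in> H" for x y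
  proof -
    \<comment> \<open>The group inverse is unary minus only for elements supported in S.\<close>
    have "Poly_Mapping.keys y \<subseteq> S"
      using subgroup.mem_carrier[OF H that(2)] by simp
    then have "- y \<in> H"
      using subgroup.m_inv_closed[OF H that(2)] by simp
    then show ?thesis
      using add[OF that(1)] by fastforce
  qed
qed

lemma keys_frag_of_diff_subset:
  assumes "a \<in> S" "b \<in> S"
  shows "Poly_Mapping.keys (frag_of a - frag_of b) \<subseteq> S"
    and "c \<in> S \<Longrightarrow> Poly_Mapping.keys (frag_of a - frag_of b - frag_of c) \<subseteq> S"
  using assms keys_diff[of "frag_of a" "frag_of b"] keys_diff[of "frag_of a - frag_of b" "frag_of c"]
  by auto

lemma tensor_relators_subset:
  assumes "module R M" "module R N"
  shows "tensor_relators R M N \<subseteq> carrier (free_Abelian_group (carrier M \<times> carrier N))"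
proof -
  interpret M: module R M by fact
  interpret N: module R N by fact
  show ?thesis
  proof
    fix t assume "t \<in> tensor_relators R M N"
    then show "t \<in> carrier (free_Abelian_group (carrier M \<times> carrier N))"
      unfolding tensor_relators_def carrier_free_Abelian_group_iff
      by (elim UnE CollectE exE conjE) (simp_all add: keys_frag_of_diff_subset)
  qed
qed

lemmas tensor_relations_closed =
  generate_free_Abelian_group_closed[OF tensor_relations_def tensor_relators_subset]

text \<open>\<open>frag_of (x, y) \<in> H\<close> reads "the pure tensor of x and y is 0". The
  first, second and fourth facts make the x whose pure tensors with all y vanish into a submodule,
  as \<open>ideal_smult_least\<close> requires.\<close>

lemma tensor_relations_eqs:
  assumes "module R M" "module R N"
  defines "H \<equiv> tensor_relations R M N"
  shows "\<lbrakk>x \<in> carrier M; x' \<in> carrier M; y \<in> carrier N; frag_of (x, y) \<in> H; frag_of (x', y) \<in> H\<rbrakk>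
      \<Longrightarrow> frag_of (x \<oplus>\<^bsub>M\<^esub> x', y) \<in> H" (is "PROP ?A")
    and "y \<in> carrier N \<Longrightarrow> frag_of (\<zero>\<^bsub>M\<^esub>, y) \<in> H" (is "PROP ?B")
    and "x \<in> carrier M \<Longrightarrow> frag_of (x, \<zero>\<^bsub>N\<^esub>) \<in> H" (is "PROP ?C")
    and "\<lbrakk>r \<in> carrier R; x \<in> carrier M; y \<in> carrier N\<rbrakk>
      \<Longrightarrow> frag_of (r \<odot>\<^bsub>M\<^esub> x, y) \<in> H \<longleftrightarrow> frag_of (x, r \<odot>\<^bsub>N\<^esub> y) \<in> H" (is "PROP ?D")
proof -
  interpret M: module R M by fact
  interpret N: module R N by fact
  note cl = tensor_relations_closed[OF assms(1,2), folded H_def]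
  have rel: "t \<in> tensor_relators R M N \<Longrightarrow> t \<in> H" for t using cl(2) by blast
  have right: "u \<in> H" if "u - v \<in> H" "v \<in> H" for u v
    using cl(4)[OF that] by simp
  have left: "v \<in> H" if "u - v \<in> H" "u \<in> H" for u v
    using cl(5)[OF that(2,1)] by simp
  show "PROP ?A"
  proof -
    assume *: "x \<in> carrier M" "x' \<in> carrier M" "y \<in> carrier N" "frag_of (x, y) \<in> H" "frag_of (x', y) \<in> H"
    then have "frag_of (x \<oplus>\<^bsub>M\<^esub> x', y) - frag_of (x, y) - frag_of (x', y) \<in> H"
      by (intro rel) (auto simp: tensor_relators_def)
    then show ?thesis using right * by blast
  qed
  show "PROP ?B"
  proof -
    assume "y \<in> carrier N"
    \<comment> \<open>As 0 + 0 = 0, this relator equals minus \<open>frag_of (0, y)\<close>.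
      Simplification of 0 + 0 is switched off so that the relator is still recognised.\<close>
    then have "frag_of (\<zero>\<^bsub>M\<^esub> \<oplus>\<^bsub>M\<^esub> \<zero>\<^bsub>M\<^esub>, y) - frag_of (\<zero>\<^bsub>M\<^esub>, y) - frag_of (\<zero>\<^bsub>M\<^esub>, y) \<in> H"
      unfolding tensor_relators_def by (intro rel) (auto simp: tensor_relators_def simp del: M.M.r_zero M.M.l_zero)
    then show ?thesis using cl(5)[OF cl(3)] by fastforce
  qed
  show "PROP ?C"
  proof -
    assume "x \<in> carrier M"
    then have "frag_of (x, \<zero>\<^bsub>N\<^esub> \<oplus>\<^bsub>N\<^esub> \<zero>\<^bsub>N\<^esub>) - frag_of (x, \<zero>\<^bsub>N\<^esub>) - frag_of (x, \<zero>\<^bsub>N\<^esub>) \<in> H"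
      by (intro rel) (auto simp: tensor_relators_def simp del: N.M.r_zero N.M.l_zero)
    then show ?thesis using cl(5)[OF cl(3)] by fastforce
  qed
  show "PROP ?D"
  proof -
    assume "r \<in> carrier R" "x \<in> carrier M" "y \<in> carrier N"
    then have "frag_of (r \<odot>\<^bsub>M\<^esub> x, y) - frag_of (x, r \<odot>\<^bsub>N\<^esub> y) \<in> H"
      by (intro rel) (auto simp: tensor_relators_def)
    then show ?thesis using left right by blast
  qed
qed

lemma (in subgroup) set_mult_absorb:
  assumes "group G" "T \<subseteq> H" "T \<noteq> {}"
  shows "H <#> T = H"
proof
  interpret group G by fact
  show "H <#> T \<subseteq> H" using assms by (auto simp: set_mult_def)
  obtain t where t: "t \<in> T" using assms by auto
  have "h = (h \<otimes> inv t) \<otimes> t" "h \<otimes> inv t \<in> H" if "h \<in> H" for h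
    using that t assms(2) by (auto simp: m_assoc)
  then show "H \<subseteq> H <#> T" using t unfolding set_mult_def by blast
qed

text \<open>\<open>tensor_map\<close> adds the relations of the target once more, and a coset of the
  relations absorbs them.\<close>

lemma tensor_map_ident:
  fixes M :: "('a, 'c, 'n) module_scheme" and N :: "('a, 'd, 'k) module_scheme"
  assumes "module R M" "module R N" "p \<in> carrier (tensor R M N)"
  shows "tensor_map R M N (\<lambda>y. y) p = p"
proof -
  let ?G = "free_Abelian_group (carrier M \<times> carrier N)"
  have "frag_extend (\<lambda>(x, y). frag_of (x, y)) z = z" for z :: "'c \<times> 'd \<Rightarrow>\<^sub>0 int"
  proof -
    have "(\<lambda>(x, y). frag_of (x, y)) = (frag_of :: 'c \<times> 'd \<Rightarrow> _)" by (rule case_prod_eta)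
    then show ?thesis by (metis frag_expansion)
  qed
  then have "frag_extend (\<lambda>(x, y). frag_of (x, y)) ` p = p" by simp
  moreover have "tensor_relations R M N \<lhd> ?G"
    by (rule comm_group.subgroup_imp_normal[OF abelian_free_Abelian_group tensor_relations_closed(1)])
      (use assms in auto)
  ultimately show ?thesis
    using normal.rcosets_mult_eq[of "tensor_relations R M N" ?G p] assms(3)
    by (simp add: tensor_map_def tensor_def FactGroup_def)
qed

text \<open>Since the generators go into the relations of N', so does the whole free group. The
  image of a coset is then a nonempty part of the relations subgroup, which absorbs it and leaves
  the neutral coset.\<close>

lemma tensor_map_eq_one:
  assumes "module R M" "module R N'" "p \<in> carrier (tensor R M N)"
    and f: "\<And>x y. x \<in> carrier M \<Longrightarrow> y \<in> carrier N \<Longrightarrow> frag_of (x, f y) \<in> tensor_relations R M N'"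
    and N: "module R N"
  shows "tensor_map R M N' f p = \<one>\<^bsub>tensor R M N'\<^esub>"
proof -
  let ?G = "free_Abelian_group (carrier M \<times> carrier N)" and ?F = "frag_extend (\<lambda>(x, y). frag_of (x, f y))"
  note cl = tensor_relations_closed[OF assms(1,2)]
  obtain z where z: "z \<in> carrier ?G" "p = tensor_relations R M N #>\<^bsub>?G\<^esub> z"
    using assms(3) by (auto simp: tensor_def FactGroup_def RCOSETS_def)
  have "p \<subseteq> carrier ?G"
    using monoid.r_coset_subset_G[OF group.is_monoid[OF group_free_Abelian_group]] z
      subgroup.subset[OF tensor_relations_closed(1)[OF assms(1) N]] by blast
  moreover have "?F w \<in> tensor_relations R M N'" if "w \<in> carrier ?G" for w
  proof (rule free_Abelian_group_induct[of w "carrier M \<times> carrier N"])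
    show "Poly_Mapping.keys w \<subseteq> carrier M \<times> carrier N" using that by simp
  qed (use cl f in \<open>auto simp: frag_extend_diff\<close>)
  ultimately have "?F ` p \<subseteq> tensor_relations R M N'" by blast
  moreover have "p \<noteq> {}"
    using z(2) subgroup.one_closed[OF tensor_relations_closed(1)[OF assms(1) N]]
    by (auto simp: r_coset_def)
  ultimately show ?thesis
    using subgroup.set_mult_absorb[OF cl(1) group_free_Abelian_group]
    by (simp add: tensor_map_def tensor_def FactGroup_def)
qed

text \<open>In the tensor product with N = R/I, moving scalars across gives (a x, y) ~ (x, a y) =
  (x, 0) for a in I, so elements of IM contribute nothing; applied to r x, this kills (x, r y). The
  test sequence ends with the identity, so that its exactness says that multiplication by r vanishes
  on N.\<close>

lemma (in module) residual_ideal_smult_flat: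
  assumes "faithfully_flat R M" and I: "ideal I R"
  shows "residual R M (ideal_smult R I M) \<subseteq> I"
proof
  fix r assume "r \<in> residual R M (ideal_smult R I M)"
  then have r: "r \<in> carrier R" "\<And>x. x \<in> carrier M \<Longrightarrow> r \<odot>\<^bsub>M\<^esub> x \<in> ideal_smult R I M"
    by (auto simp: residual_def)
  define N where "N = quot_module R I"
  define f where "f = (\<odot>\<^bsub>N\<^esub>) r"
  define H where "H = tensor_relations R M N"
  have N: "module R N" unfolding N_def by (rule module_quot_module[OF I])
  interpret N: module R N by fact
  note eqs = tensor_relations_eqs[OF module_axioms N, folded H_def]
  have f: "f \<in> lin_maps R N N"
    using r(1) by (auto simp: f_def lin_maps_def N.smult_r_distr N.smult_assoc1[symmetric] m_comm)
  have id: "(\<lambda>y. y) \<in> lin_maps R N N"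
    by (auto simp: lin_maps_def)
  have "ideal_smult R I M \<subseteq> {x \<in> carrier M. \<forall>y\<in>carrier N. frag_of (x, y) \<in> H}"
  proof (rule ideal_smult_least[OF submodule_of_closed])
    fix a x assume a: "a \<in> I" and x: "x \<in> carrier M"
    have "a \<odot>\<^bsub>N\<^esub> y = \<zero>\<^bsub>N\<^esub>" if y: "y \<in> carrier N" for y
    proof -
      obtain s where s: "s \<in> carrier R" "y = I +> s"
        using y by (auto simp: N_def carrier_quot_module)
      have "I +> (a \<otimes> s) = I"
        using a_rcos_zero[OF I] ideal.I_r_closed[OF I a s(1)] by simp
      then show ?thesis
        using smult_quot_module[OF I ideal.Icarr[OF I a] s(1)]
        by (simp add: N_def s(2) zero_quot_module)
    qed
    then show "a \<odot>\<^bsub>M\<^esub> x \<in> {x \<in> carrier M. \<forall>y\<in>carrier N. frag_of (x, y) \<in> H}"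
      using eqs(3,4) x ideal.Icarr[OF I a] by simp
  qed (use eqs in auto)
  then have "frag_of (r \<odot>\<^bsub>M\<^esub> x, y) \<in> H" if "x \<in> carrier M" "y \<in> carrier N" for x y
    using r(2)[OF that(1)] that(2) by blast
  then have "frag_of (x, f y) \<in> H" if "x \<in> carrier M" "y \<in> carrier N" for x y
    using eqs(4)[OF r(1) that] that by (simp add: f_def)
  then have one: "tensor_map R M N f p = \<one>\<^bsub>tensor R M N\<^esub>" if "p \<in> carrier (tensor R M N)" for p
    using tensor_map_eq_one[OF module_axioms N that _ N, of f] by (simp add: H_def)
  \<comment> \<open>The image has to be exactly the trivial kernel, so the tensor product must be
    known to be nonempty.\<close>
  have "\<one>\<^bsub>tensor R M N\<^esub> \<in> carrier (tensor R M N)"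
  proof -
    let ?G = "free_Abelian_group (carrier M \<times> carrier N)"
    have "H \<lhd> ?G" unfolding H_def
      by (rule comm_group.subgroup_imp_normal[OF abelian_free_Abelian_group tensor_relations_closed(1)[OF module_axioms N]])
    then show ?thesis
      using group.is_monoid[OF normal.factorgroup_is_group] monoid.one_closed
      by (metis H_def tensor_def)
  qed
  then have "tensor_map R M N f ` carrier (tensor R M N)
      = kernel (tensor R M N) (tensor R M N) (tensor_map R M N (\<lambda>y. y))"
    using one tensor_map_ident[OF module_axioms N] by (auto simp: kernel_def)
  then have ex: "f ` carrier N = {y \<in> carrier N. y = \<zero>\<^bsub>N\<^esub>}"
    using assms(1)[unfolded faithfully_flat_def, rule_format, OF N N N f id] by simp
  have "I +> \<one> \<in> carrier N" by (auto simp: N_def carrier_quot_module)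
  then have "f (I +> \<one>) = \<zero>\<^bsub>N\<^esub>" using ex by blast
  then have "I +> r = I"
    using r(1) smult_quot_module[OF I r(1), of \<one>] by (simp add: f_def N_def zero_quot_module)
  then show "r \<in> I"
    using ideal.rcos_const_imp_mem[OF I r(1)] by simp
qed

lemma (in module) quasi_primeful_faithfully_flat:
  assumes "faithfully_flat R M"
  shows "quasi_primeful R M"
proof (rule quasi_primefulI, rule conjI)
  \<comment> \<open>The residual bound for I = 0 makes M faithful. All ideals then lie above Ann(M),
    and quasi-primeness of I needs no lifting.\<close>
  have "annihilator R M \<subseteq> {\<zero>}"
  proof -
    have "annihilator R M \<subseteq> residual R M (ideal_smult R {\<zero>} M)"
      by (rule annihilator_subset_residual[OF submodule_ideal_smult]) auto
    then show ?thesis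
      using residual_ideal_smult_flat[OF assms zeroideal] by blast
  qed
  then have ann: "annihilator R M \<subseteq> A" if "ideal A R" for A
    using additive_subgroup.zero_closed[OF ideal.axioms(1)[OF that]] by auto
  fix I assume I: "ideal I R" "I \<noteq> carrier R"
    and prime: "\<And>A B. \<lbrakk>ideal A R; ideal B R; annihilator R M \<subseteq> A; annihilator R M \<subseteq> B; A \<inter> B \<subseteq> I\<rbrakk>
      \<Longrightarrow> A \<subseteq> I \<or> B \<subseteq> I"
  show "quasi_prime_ideal R I"
    unfolding quasi_prime_ideal_def using I prime ann by simp
  show "residual R M (ideal_smult R I M) \<subseteq> I"
    by (rule residual_ideal_smult_flat[OF assms I(1)])
qed

section \<open>Localisation\<close>

lemma (in cring) module_self_module: "module R (self_module R)"
proof (rule moduleI)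
  show "abelian_group (self_module R)"
    by (rule abelian_groupI) (auto simp: self_module_def a_ac intro: l_neg a_inv_closed)
  show "cring R" by (rule is_cring)
qed (auto simp: self_module_def l_distr r_distr m_assoc)

locale localization = module +
  fixes S
  assumes S_subset: "S \<subseteq> carrier R"
    and one_S: "\<one> \<in> S"
    and mult_S: "s \<in> S \<Longrightarrow> t \<in> S \<Longrightarrow> s \<otimes> t \<in> S"
begin

abbreviation "mfrac \<equiv> fraction M S"
abbreviation "rfrac \<equiv> fraction (self_module R) S"
abbreviation "RS \<equiv> loc_ring R S"
abbreviation "MS \<equiv> loc_module R S M"

lemma localization_self_module: "localization R (self_module R) S"
  by (intro localization.intro module_self_module localization_axioms.intro S_subset one_S mult_S)

lemma S_carrier: "s \<in> S \<Longrightarrow> s \<in> carrier R"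
  using S_subset by auto

lemma smult_cong:
  assumes "a \<odot>\<^bsub>M\<^esub> x = b \<odot>\<^bsub>M\<^esub> y" "x \<in> carrier M" "y \<in> carrier M"
    "a \<in> carrier R" "b \<in> carrier R" "c \<in> carrier R"
  shows "(c \<otimes> a) \<odot>\<^bsub>M\<^esub> x = (c \<otimes> b) \<odot>\<^bsub>M\<^esub> y"
  using assms by (simp add: smult_assoc1)

lemma frac_rel_iff:
  "((x, s), (y, t)) \<in> frac_rel M S \<longleftrightarrow>
    x \<in> carrier M \<and> s \<in> S \<and> y \<in> carrier M \<and> t \<in> S \<and>
    (\<exists>u\<in>S. (u \<otimes> t) \<odot>\<^bsub>M\<^esub> x = (u \<otimes> s) \<odot>\<^bsub>M\<^esub> y)"
  by (auto simp: frac_rel_def smult_assoc1 S_carrier)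

lemma equiv_frac_rel: "equiv (carrier M \<times> S) (frac_rel M S)"
proof (rule equivI)
  show "frac_rel M S \<subseteq> (carrier M \<times> S) \<times> (carrier M \<times> S)"
    by (auto simp: frac_rel_def)
  show "refl_on (carrier M \<times> S) (frac_rel M S)"
    using one_S by (auto simp: refl_on_def frac_rel_iff)
  show "sym (frac_rel M S)"
    by (rule symI) (metis frac_rel_iff surj_pair)
  show "trans (frac_rel M S)"
  proof (rule transI)
    fix p q r assume "(p, q) \<in> frac_rel M S" "(q, r) \<in> frac_rel M S"
    then obtain x s y t z w u v where *: "p = (x, s)" "q = (y, t)" "r = (z, w)"
      "x \<in> carrier M" "y \<in> carrier M" "z \<in> carrier M" "s \<in> S" "t \<in> S" "w \<in> S" "u \<in> S" "v \<in> S"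
      "(u \<otimes> t) \<odot>\<^bsub>M\<^esub> x = (u \<otimes> s) \<odot>\<^bsub>M\<^esub> y" "(v \<otimes> w) \<odot>\<^bsub>M\<^esub> y = (v \<otimes> t) \<odot>\<^bsub>M\<^esub> z"
      by (cases p; cases q; cases r) (auto simp: frac_rel_iff)
    note c = *(4-6) *(7-11)[THEN S_carrier]
    \<comment> \<open>The first equation is multiplied by v w and the second by u s, so that they
      meet at y. The factor u v t common to both ends is the witness for (p, r).\<close>
    have "((v \<otimes> w) \<otimes> (u \<otimes> t)) \<odot>\<^bsub>M\<^esub> x = ((v \<otimes> w) \<otimes> (u \<otimes> s)) \<odot>\<^bsub>M\<^esub> y"
      by (rule smult_cong) (use * c in auto)
    also have "\<dots> = ((u \<otimes> s) \<otimes> (v \<otimes> w)) \<odot>\<^bsub>M\<^esub> y"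
      using c by (simp add: m_comm)
    also have "\<dots> = ((u \<otimes> s) \<otimes> (v \<otimes> t)) \<odot>\<^bsub>M\<^esub> z"
      by (rule smult_cong) (use * c in auto)
    finally have "((u \<otimes> v \<otimes> t) \<otimes> w) \<odot>\<^bsub>M\<^esub> x = ((u \<otimes> v \<otimes> t) \<otimes> s) \<odot>\<^bsub>M\<^esub> z"
      using c by (simp add: m_ac)
    then show "(p, r) \<in> frac_rel M S"
      using * by (auto simp: frac_rel_iff intro!: bexI[of _ "u \<otimes> v \<otimes> t"] mult_S)
  qed
qed

lemma mfrac_eq_iff:
  "\<lbrakk>x \<in> carrier M; y \<in> carrier M; s \<in> S; t \<in> S\<rbrakk> \<Longrightarrow>
    mfrac x s = mfrac y t \<longleftrightarrow> (\<exists>u\<in>S. (u \<otimes> t) \<odot>\<^bsub>M\<^esub> x = (u \<otimes> s) \<odot>\<^bsub>M\<^esub> y)"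
  unfolding fraction_def
  by (subst eq_equiv_class_iff[OF equiv_frac_rel]) (auto simp: frac_rel_iff)

lemma mem_mfrac:
  "(y, t) \<in> mfrac x s \<longleftrightarrow>
    x \<in> carrier M \<and> s \<in> S \<and> y \<in> carrier M \<and> t \<in> S \<and>
    (\<exists>u\<in>S. (u \<otimes> t) \<odot>\<^bsub>M\<^esub> x = (u \<otimes> s) \<odot>\<^bsub>M\<^esub> y)"
  by (simp add: fraction_def frac_rel_iff)

lemma self_mem_mfrac: "\<lbrakk>x \<in> carrier M; s \<in> S\<rbrakk> \<Longrightarrow> (x, s) \<in> mfrac x s"
  using one_S by (auto simp: mem_mfrac)

lemma carrier_MS: "carrier MS = {mfrac x s | x s. x \<in> carrier M \<and> s \<in> S}"
  by (auto simp: loc_module_def quotient_def fraction_def)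

lemma mfrac_closed: "\<lbrakk>x \<in> carrier M; s \<in> S\<rbrakk> \<Longrightarrow> mfrac x s \<in> carrier MS"
  by (auto simp: carrier_MS)

lemma MS_cases:
  assumes "p \<in> carrier MS"
  obtains x s where "x \<in> carrier M" "s \<in> S" "p = mfrac x s"
  using assms by (auto simp: carrier_MS)

lemma mfrac_cancel:
  assumes "x \<in> carrier M" "s \<in> S" "u \<in> S"
  shows "mfrac (u \<odot>\<^bsub>M\<^esub> x) (u \<otimes> s) = mfrac x s"
  using assms one_S
  by (subst mfrac_eq_iff)
    (auto simp: mult_S S_carrier smult_assoc1[symmetric] m_ac intro!: bexI[of _ \<one>])

text \<open>Well-definedness in the form needed for operations given as unions over representatives:
  equal contributions over a nonempty index set.\<close>

lemma UN_pair_const: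
  assumes "(x, s) \<in> p" "(y, t) \<in> q"
    "\<And>x' s' y' t'. (x', s') \<in> p \<Longrightarrow> (y', t') \<in> q \<Longrightarrow> F x' s' y' t' = F x s y t"
  shows "(\<Union>(x, s)\<in>p. \<Union>(y, t)\<in>q. F x s y t) = F x s y t"
  using assms by fast

lemma mfrac_add:
  assumes "x \<in> carrier M" "s \<in> S" "y \<in> carrier M" "t \<in> S"
  shows "mfrac x s \<oplus>\<^bsub>MS\<^esub> mfrac y t = mfrac (t \<odot>\<^bsub>M\<^esub> x \<oplus>\<^bsub>M\<^esub> s \<odot>\<^bsub>M\<^esub> y) (s \<otimes> t)"
proof -
  have "mfrac (t' \<odot>\<^bsub>M\<^esub> x' \<oplus>\<^bsub>M\<^esub> s' \<odot>\<^bsub>M\<^esub> y') (s' \<otimes> t') = mfrac (t \<odot>\<^bsub>M\<^esub> x \<oplus>\<^bsub>M\<^esub> s \<odot>\<^bsub>M\<^esub> y) (s \<otimes> t)"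
    if p: "(x', s') \<in> mfrac x s" and q: "(y', t') \<in> mfrac y t" for x' s' y' t'
  proof -
    obtain u v where uv: "u \<in> S" "v \<in> S"
      "(u \<otimes> s') \<odot>\<^bsub>M\<^esub> x = (u \<otimes> s) \<odot>\<^bsub>M\<^esub> x'" "(v \<otimes> t') \<odot>\<^bsub>M\<^esub> y = (v \<otimes> t) \<odot>\<^bsub>M\<^esub> y'"
      using p q by (auto simp: mem_mfrac)
    have p': "x' \<in> carrier M" "s' \<in> S" "y' \<in> carrier M" "t' \<in> S"
      using p q by (auto simp: mem_mfrac)
    note c = assms(1,3) p'(1,3) assms(2,4)[THEN S_carrier] p'(2,4)[THEN S_carrier] uv(1,2)[THEN S_carrier]
    \<comment> \<open>The two equations are scaled by v t t' and u s s', which gives every term the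
      factor u v. This factor is the witness for the equality of the two sums.\<close>
    have 1: "((v \<otimes> t \<otimes> t') \<otimes> (u \<otimes> s')) \<odot>\<^bsub>M\<^esub> x = ((v \<otimes> t \<otimes> t') \<otimes> (u \<otimes> s)) \<odot>\<^bsub>M\<^esub> x'"
      by (rule smult_cong[OF uv(3)]) (use c in auto)
    have 2: "((u \<otimes> s \<otimes> s') \<otimes> (v \<otimes> t')) \<odot>\<^bsub>M\<^esub> y = ((u \<otimes> s \<otimes> s') \<otimes> (v \<otimes> t)) \<odot>\<^bsub>M\<^esub> y'"
      by (rule smult_cong[OF uv(4)]) (use c in auto)
    have "((u \<otimes> v) \<otimes> (s \<otimes> t)) \<odot>\<^bsub>M\<^esub> (t' \<odot>\<^bsub>M\<^esub> x' \<oplus>\<^bsub>M\<^esub> s' \<odot>\<^bsub>M\<^esub> y')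
        = ((v \<otimes> t \<otimes> t') \<otimes> (u \<otimes> s)) \<odot>\<^bsub>M\<^esub> x' \<oplus>\<^bsub>M\<^esub> ((u \<otimes> s \<otimes> s') \<otimes> (v \<otimes> t)) \<odot>\<^bsub>M\<^esub> y'"
      using c by (simp add: smult_r_distr smult_assoc1[symmetric] m_ac)
    also have "\<dots> = ((v \<otimes> t \<otimes> t') \<otimes> (u \<otimes> s')) \<odot>\<^bsub>M\<^esub> x \<oplus>\<^bsub>M\<^esub> ((u \<otimes> s \<otimes> s') \<otimes> (v \<otimes> t')) \<odot>\<^bsub>M\<^esub> y"
      by (simp only: 1 2)
    also have "\<dots> = ((u \<otimes> v) \<otimes> (s' \<otimes> t')) \<odot>\<^bsub>M\<^esub> (t \<odot>\<^bsub>M\<^esub> x \<oplus>\<^bsub>M\<^esub> s \<odot>\<^bsub>M\<^esub> y)"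
      using c by (simp add: smult_r_distr smult_assoc1[symmetric] m_ac)
    finally show ?thesis
      using c p' assms uv(1,2) by (subst mfrac_eq_iff) (auto intro: mult_S)
  qed
  then have "(\<Union>(x, s)\<in>mfrac x s. \<Union>(y, t)\<in>mfrac y t. mfrac (t \<odot>\<^bsub>M\<^esub> x \<oplus>\<^bsub>M\<^esub> s \<odot>\<^bsub>M\<^esub> y) (s \<otimes> t))
      = mfrac (t \<odot>\<^bsub>M\<^esub> x \<oplus>\<^bsub>M\<^esub> s \<odot>\<^bsub>M\<^esub> y) (s \<otimes> t)"
    by (rule UN_pair_const[OF self_mem_mfrac[OF assms(1,2)] self_mem_mfrac[OF assms(3,4)]])
  then show ?thesis
    by (simp add: loc_module_def)
qed

lemma smult_self_module: "a \<odot>\<^bsub>self_module R\<^esub> b = a \<otimes> b"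
  by (simp add: self_module_def)

lemma carrier_self_module: "carrier (self_module R) = carrier R"
  by (simp add: self_module_def)

lemmas rfrac_simps = smult_self_module carrier_self_module

lemmas rfrac_eq_iff = localization.mfrac_eq_iff[OF localization_self_module, unfolded rfrac_simps]
lemmas mem_rfrac = localization.mem_mfrac[OF localization_self_module, unfolded rfrac_simps]
lemmas self_mem_rfrac = localization.self_mem_mfrac[OF localization_self_module, unfolded rfrac_simps]

lemma rfrac_smult_mfrac:
  assumes "a \<in> carrier R" "s \<in> S" "y \<in> carrier M" "t \<in> S"
  shows "rfrac a s \<odot>\<^bsub>MS\<^esub> mfrac y t = mfrac (a \<odot>\<^bsub>M\<^esub> y) (s \<otimes> t)"
proof -
  have "mfrac (a' \<odot>\<^bsub>M\<^esub> y') (s' \<otimes> t') = mfrac (a \<odot>\<^bsub>M\<^esub> y) (s \<otimes> t)"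
    if p: "(a', s') \<in> rfrac a s" and q: "(y', t') \<in> mfrac y t" for a' s' y' t'
  proof -
    obtain u v where uv: "u \<in> S" "v \<in> S"
      "u \<otimes> s' \<otimes> a = u \<otimes> s \<otimes> a'" "(v \<otimes> t') \<odot>\<^bsub>M\<^esub> y = (v \<otimes> t) \<odot>\<^bsub>M\<^esub> y'"
      using p q by (auto simp: mem_mfrac mem_rfrac)
    have p': "a' \<in> carrier R" "s' \<in> S" "y' \<in> carrier M" "t' \<in> S"
      using p q by (auto simp: mem_mfrac mem_rfrac)
    note c = assms(1,3) p'(1,3) assms(2,4)[THEN S_carrier] p'(2,4)[THEN S_carrier] uv(1,2)[THEN S_carrier]
    have "((u \<otimes> v) \<otimes> (s \<otimes> t)) \<odot>\<^bsub>M\<^esub> (a' \<odot>\<^bsub>M\<^esub> y') = ((u \<otimes> s \<otimes> a') \<otimes> (v \<otimes> t)) \<odot>\<^bsub>M\<^esub> y'"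
      using c by (simp add: smult_assoc1[symmetric] m_ac)
    also have "\<dots> = ((u \<otimes> s \<otimes> a') \<otimes> (v \<otimes> t')) \<odot>\<^bsub>M\<^esub> y"
      by (rule smult_cong[OF uv(4)[symmetric]]) (use c in auto)
    also have "\<dots> = ((u \<otimes> s' \<otimes> a) \<otimes> (v \<otimes> t')) \<odot>\<^bsub>M\<^esub> y"
      by (simp only: uv(3))
    also have "\<dots> = ((u \<otimes> v) \<otimes> (s' \<otimes> t')) \<odot>\<^bsub>M\<^esub> (a \<odot>\<^bsub>M\<^esub> y)"
      using c by (simp add: smult_assoc1[symmetric] m_ac)
    finally show ?thesis
      using c p' assms uv(1,2) by (subst mfrac_eq_iff) (auto intro: mult_S)
  qed
  then have "(\<Union>(a, s)\<in>rfrac a s. \<Union>(y, t)\<in>mfrac y t. mfrac (a \<odot>\<^bsub>M\<^esub> y) (s \<otimes> t))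
      = mfrac (a \<odot>\<^bsub>M\<^esub> y) (s \<otimes> t)"
    by (rule UN_pair_const[OF self_mem_rfrac[OF assms(1,2)] self_mem_mfrac[OF assms(3,4)]])
  then show ?thesis
    by (simp add: loc_module_def)
qed

lemma zero_MS: "\<zero>\<^bsub>MS\<^esub> = mfrac \<zero>\<^bsub>M\<^esub> \<one>"
  by (simp add: loc_module_def)

lemma mfrac_zero:
  assumes "s \<in> S" shows "mfrac \<zero>\<^bsub>M\<^esub> s = \<zero>\<^bsub>MS\<^esub>"
  unfolding zero_MS using mfrac_cancel[of "\<zero>\<^bsub>M\<^esub>" \<one> s] assms one_S by (simp add: S_carrier)

lemma abelian_group_MS: "abelian_group MS"
proof (rule abelian_groupI)
  fix p q r assume "p \<in> carrier MS" "q \<in> carrier MS" "r \<in> carrier MS"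
  then obtain x s y t z w where *: "x \<in> carrier M" "y \<in> carrier M" "z \<in> carrier M" "s \<in> S" "t \<in> S" "w \<in> S"
    "p = mfrac x s" "q = mfrac y t" "r = mfrac z w"
    by (metis MS_cases)
  then show "p \<oplus>\<^bsub>MS\<^esub> q \<oplus>\<^bsub>MS\<^esub> r = p \<oplus>\<^bsub>MS\<^esub> (q \<oplus>\<^bsub>MS\<^esub> r)"
    by (simp add: mfrac_add mult_S S_carrier smult_r_distr smult_assoc1[symmetric] m_ac M.a_ac)
next
  fix p q assume "p \<in> carrier MS" "q \<in> carrier MS"
  then obtain x s y t where *: "x \<in> carrier M" "y \<in> carrier M" "s \<in> S" "t \<in> S"
    "p = mfrac x s" "q = mfrac y t"
    by (metis MS_cases)
  then show "p \<oplus>\<^bsub>MS\<^esub> q = q \<oplus>\<^bsub>MS\<^esub> p" "p \<oplus>\<^bsub>MS\<^esub> q \<in> carrier MS"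
    by (simp_all add: mfrac_add mult_S S_carrier m_comm M.a_comm mfrac_closed)
next
  show "\<zero>\<^bsub>MS\<^esub> \<in> carrier MS"
    by (simp add: zero_MS mfrac_closed one_S)
next
  fix p assume "p \<in> carrier MS"
  then obtain x s where *: "x \<in> carrier M" "s \<in> S" "p = mfrac x s"
    by (metis MS_cases)
  then show "\<zero>\<^bsub>MS\<^esub> \<oplus>\<^bsub>MS\<^esub> p = p"
    by (simp add: zero_MS mfrac_add one_S S_carrier)
  have "mfrac (\<ominus>\<^bsub>M\<^esub> x) s \<oplus>\<^bsub>MS\<^esub> p = \<zero>\<^bsub>MS\<^esub>"
    using * by (simp add: mfrac_add S_carrier smult_r_minus M.l_neg mfrac_zero mult_S)
  then show "\<exists>q\<in>carrier MS. q \<oplus>\<^bsub>MS\<^esub> p = \<zero>\<^bsub>MS\<^esub>"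
    using * mfrac_closed[of "\<ominus>\<^bsub>M\<^esub> x" s] by auto
qed

text \<open>The records have different types and are compared field by field. Multiplication of
  \<open>RS\<close> is the scalar multiplication of the localised self-module, so the rules for
  \<open>rfrac\<close>, well-definedness included, are instances of those for
  \<open>mfrac\<close>.\<close>

lemma RS_eq_loc_module:
  "carrier RS = carrier (loc_module R S (self_module R))"
  "add RS = add (loc_module R S (self_module R))"
  "\<zero>\<^bsub>RS\<^esub> = \<zero>\<^bsub>loc_module R S (self_module R)\<^esub>"
  "monoid.mult RS = smult (loc_module R S (self_module R))"
  by (simp_all add: loc_ring_def loc_module_def self_module_def)

lemma one_RS: "\<one>\<^bsub>RS\<^esub> = rfrac \<one> \<one>"
  by (simp add: loc_ring_def)

lemma add_self_module: "a \<oplus>\<^bsub>self_module R\<^esub> b = a \<oplus> b"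
  by (simp add: self_module_def)

lemmas rfrac_add = localization.mfrac_add[OF localization_self_module, folded RS_eq_loc_module, unfolded rfrac_simps add_self_module]
lemmas rfrac_mult = localization.rfrac_smult_mfrac[OF localization_self_module, folded RS_eq_loc_module, unfolded rfrac_simps]
lemmas rfrac_closed = localization.mfrac_closed[OF localization_self_module, folded RS_eq_loc_module, unfolded rfrac_simps]
lemmas rfrac_cancel = localization.mfrac_cancel[OF localization_self_module, unfolded rfrac_simps]
lemmas RS_cases = localization.MS_cases[OF localization_self_module, folded RS_eq_loc_module, unfolded rfrac_simps]

lemma abelian_group_RS: "abelian_group RS"
proof -
  interpret A: abelian_group "loc_module R S (self_module R)"
    by (rule localization.abelian_group_MS[OF localization_self_module])
  show ?thesis
    by (rule abelian_groupI) (auto simp: RS_eq_loc_module A.a_ac intro: A.l_neg A.a_inv_closed)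
qed

lemma cring_RS: "cring RS"
proof (rule cringI[OF abelian_group_RS comm_monoidI])
  show "\<one>\<^bsub>RS\<^esub> \<in> carrier RS"
    by (simp add: one_RS rfrac_closed one_S)
next
  fix p q r assume "p \<in> carrier RS" "q \<in> carrier RS" "r \<in> carrier RS"
  then obtain x s y t z w where *: "x \<in> carrier R" "y \<in> carrier R" "z \<in> carrier R" "s \<in> S" "t \<in> S" "w \<in> S"
    "p = rfrac x s" "q = rfrac y t" "r = rfrac z w"
    by (metis RS_cases)
  then show "p \<otimes>\<^bsub>RS\<^esub> q \<otimes>\<^bsub>RS\<^esub> r = p \<otimes>\<^bsub>RS\<^esub> (q \<otimes>\<^bsub>RS\<^esub> r)"
    by (simp add: rfrac_mult mult_S S_carrier m_ac)
  \<comment> \<open>The left side has denominator s t w and the sum on the right s w t w. Expanding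
    the left fraction by w makes both sides the same fraction; the distributive laws of
    \<open>MS\<close> are treated alike.\<close>
  have "(p \<oplus>\<^bsub>RS\<^esub> q) \<otimes>\<^bsub>RS\<^esub> r = rfrac (w \<otimes> ((t \<otimes> x \<oplus> s \<otimes> y) \<otimes> z)) (w \<otimes> (s \<otimes> t \<otimes> w))"
    using * by (simp add: rfrac_cancel rfrac_add rfrac_mult mult_S S_carrier)
  also have "\<dots> = p \<otimes>\<^bsub>RS\<^esub> r \<oplus>\<^bsub>RS\<^esub> q \<otimes>\<^bsub>RS\<^esub> r"
    using * by (simp add: rfrac_add rfrac_mult mult_S S_carrier l_distr r_distr m_ac)
  finally show "(p \<oplus>\<^bsub>RS\<^esub> q) \<otimes>\<^bsub>RS\<^esub> r = p \<otimes>\<^bsub>RS\<^esub> r \<oplus>\<^bsub>RS\<^esub> q \<otimes>\<^bsub>RS\<^esub> r" .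
next
  fix p q assume "p \<in> carrier RS" "q \<in> carrier RS"
  then obtain x s y t where *: "x \<in> carrier R" "y \<in> carrier R" "s \<in> S" "t \<in> S"
    "p = rfrac x s" "q = rfrac y t"
    by (metis RS_cases)
  then show "p \<otimes>\<^bsub>RS\<^esub> q = q \<otimes>\<^bsub>RS\<^esub> p" "p \<otimes>\<^bsub>RS\<^esub> q \<in> carrier RS"
    by (simp_all add: rfrac_mult mult_S S_carrier m_comm rfrac_closed)
next
  fix p assume "p \<in> carrier RS"
  then obtain x s where *: "x \<in> carrier R" "s \<in> S" "p = rfrac x s"
    by (metis RS_cases)
  then show "\<one>\<^bsub>RS\<^esub> \<otimes>\<^bsub>RS\<^esub> p = p"
    by (simp add: one_RS rfrac_mult one_S S_carrier)
qed

lemma module_MS: "module RS MS"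
proof (rule moduleI[OF cring_RS abelian_group_MS])
  fix p q r assume "p \<in> carrier RS" "q \<in> carrier RS" "r \<in> carrier MS"
  then obtain x s y t z w where *: "x \<in> carrier R" "y \<in> carrier R" "z \<in> carrier M" "s \<in> S" "t \<in> S" "w \<in> S"
    "p = rfrac x s" "q = rfrac y t" "r = mfrac z w"
    by (metis RS_cases MS_cases)
  then show "(p \<otimes>\<^bsub>RS\<^esub> q) \<odot>\<^bsub>MS\<^esub> r = p \<odot>\<^bsub>MS\<^esub> (q \<odot>\<^bsub>MS\<^esub> r)"
    by (simp add: rfrac_mult rfrac_smult_mfrac mult_S S_carrier m_ac smult_assoc1)
  have "(p \<oplus>\<^bsub>RS\<^esub> q) \<odot>\<^bsub>MS\<^esub> r = mfrac (w \<odot>\<^bsub>M\<^esub> ((t \<otimes> x \<oplus> s \<otimes> y) \<odot>\<^bsub>M\<^esub> z)) (w \<otimes> (s \<otimes> t \<otimes> w))"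
    using * by (simp add: mfrac_cancel rfrac_add rfrac_smult_mfrac mult_S S_carrier)
  also have "\<dots> = p \<odot>\<^bsub>MS\<^esub> r \<oplus>\<^bsub>MS\<^esub> q \<odot>\<^bsub>MS\<^esub> r"
    using * by (simp add: mfrac_add rfrac_smult_mfrac mult_S S_carrier smult_l_distr smult_r_distr
        smult_assoc1[symmetric] m_ac)
  finally show "(p \<oplus>\<^bsub>RS\<^esub> q) \<odot>\<^bsub>MS\<^esub> r = p \<odot>\<^bsub>MS\<^esub> r \<oplus>\<^bsub>MS\<^esub> q \<odot>\<^bsub>MS\<^esub> r" .
next
  fix p q r assume "p \<in> carrier RS" "q \<in> carrier MS" "r \<in> carrier MS"
  then obtain x s y t z w where *: "x \<in> carrier R" "y \<in> carrier M" "z \<in> carrier M" "s \<in> S" "t \<in> S" "w \<in> S"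
    "p = rfrac x s" "q = mfrac y t" "r = mfrac z w"
    by (metis RS_cases MS_cases)
  then have "p \<odot>\<^bsub>MS\<^esub> (q \<oplus>\<^bsub>MS\<^esub> r)
      = mfrac (s \<odot>\<^bsub>M\<^esub> (x \<odot>\<^bsub>M\<^esub> (w \<odot>\<^bsub>M\<^esub> y \<oplus>\<^bsub>M\<^esub> t \<odot>\<^bsub>M\<^esub> z))) (s \<otimes> (s \<otimes> (t \<otimes> w)))"
    by (simp add: mfrac_cancel mfrac_add rfrac_smult_mfrac mult_S S_carrier)
  also have "\<dots> = p \<odot>\<^bsub>MS\<^esub> q \<oplus>\<^bsub>MS\<^esub> p \<odot>\<^bsub>MS\<^esub> r"
    using * by (simp add: mfrac_add rfrac_smult_mfrac mult_S S_carrier smult_r_distr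
        smult_assoc1[symmetric] m_ac)
  finally show "p \<odot>\<^bsub>MS\<^esub> (q \<oplus>\<^bsub>MS\<^esub> r) = p \<odot>\<^bsub>MS\<^esub> q \<oplus>\<^bsub>MS\<^esub> p \<odot>\<^bsub>MS\<^esub> r" .
next
  fix p q assume "p \<in> carrier RS" "q \<in> carrier MS"
  then obtain x s y t where *: "x \<in> carrier R" "y \<in> carrier M" "s \<in> S" "t \<in> S"
    "p = rfrac x s" "q = mfrac y t"
    by (metis RS_cases MS_cases)
  then show "p \<odot>\<^bsub>MS\<^esub> q \<in> carrier MS"
    by (simp add: rfrac_smult_mfrac mult_S mfrac_closed)
next
  fix q assume "q \<in> carrier MS"
  then obtain y t where *: "y \<in> carrier M" "t \<in> S" "q = mfrac y t"
    by (metis MS_cases)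
  then show "\<one>\<^bsub>RS\<^esub> \<odot>\<^bsub>MS\<^esub> q = q"
    by (simp add: one_RS rfrac_smult_mfrac one_S S_carrier)
qed

end

text \<open>b is a basis element and Z the span of the others. The third fact says at once that Rb
  is free and that it meets Z trivially, so the c of the fourth is a well-defined b-coordinate of
  y.\<close>

lemma (in module) free_module_split:
  assumes "free_module R M" "carrier M \<noteq> {\<zero>\<^bsub>M\<^esub>}"
  obtains b Z where "b \<in> carrier M" "submodule Z R M"
    and "\<And>c. \<lbrakk>c \<in> carrier R; c \<odot>\<^bsub>M\<^esub> b \<in> Z\<rbrakk> \<Longrightarrow> c = \<zero>"
    and "\<And>y. y \<in> carrier M \<Longrightarrow> \<exists>c\<in>carrier R. \<exists>z\<in>Z. y = c \<odot>\<^bsub>M\<^esub> b \<oplus>\<^bsub>M\<^esub> z"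
proof -
  obtain B where B: "B \<subseteq> carrier M" "lin_independent R M B" "lin_span R M B = carrier M"
    using assms(1) by (auto simp: free_module_def)
  have "B \<noteq> {}"
    using lin_span_least[OF submodule_zero, of B] B(3) assms(2) by auto
  then obtain b where b: "b \<in> B" by auto
  have bM: "b \<in> carrier M" using b B by auto
  define Z where "Z = lin_span R M (B - {b})"
  have Z: "submodule Z R M" unfolding Z_def by (rule submodule_lin_span) (use B in auto)
  note ZE = submoduleE[OF Z] submodule_zero_closed[OF Z]
  have ZM: "z \<in> carrier M" if "z \<in> Z" for z using that ZE(1) by auto
  show thesis
  proof
    show "b \<in> carrier M" "submodule Z R M" by fact+
  next
    fix c assume c: "c \<in> carrier R" "c \<odot>\<^bsub>M\<^esub> b \<in> Z"
    then obtain A d where A: "c \<odot>\<^bsub>M\<^esub> b = (\<Oplus>\<^bsub>M\<^esub>y\<in>A. d y \<odot>\<^bsub>M\<^esub> y)" "finite A" "A \<subseteq> B - {b}" "d \<in> A \<rightarrow> carrier R"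
      by (auto simp: Z_def lin_span_def)
    \<comment> \<open>The coefficient - c at b turns the expression of c b through the other basis
      elements into a vanishing combination.\<close>
    define d' where "d' = d(b := \<ominus> c)"
    have d: "d y \<odot>\<^bsub>M\<^esub> y \<in> carrier M" if "y \<in> A" for y using that A B by auto
    have "(\<Oplus>\<^bsub>M\<^esub>y\<in>A. d' y \<odot>\<^bsub>M\<^esub> y) = (\<Oplus>\<^bsub>M\<^esub>y\<in>A. d y \<odot>\<^bsub>M\<^esub> y)"
      using A(3) d by (intro M.finsum_cong') (auto simp: d'_def)
    moreover have "(\<Oplus>\<^bsub>M\<^esub>y\<in>insert b A. d' y \<odot>\<^bsub>M\<^esub> y) = d' b \<odot>\<^bsub>M\<^esub> b \<oplus>\<^bsub>M\<^esub> (\<Oplus>\<^bsub>M\<^esub>y\<in>A. d' y \<odot>\<^bsub>M\<^esub> y)"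
      by (rule M.finsum_insert) (use A c bM d in \<open>auto simp: d'_def\<close>)
    ultimately have "(\<Oplus>\<^bsub>M\<^esub>y\<in>insert b A. d' y \<odot>\<^bsub>M\<^esub> y) = \<zero>\<^bsub>M\<^esub>"
      using A(1) c(1) bM ZM[OF c(2)] by (simp add: d'_def smult_l_minus M.l_neg)
    moreover have "d' \<in> insert b A \<rightarrow> carrier R" "insert b A \<subseteq> B" "finite (insert b A)"
      using A c b by (auto simp: d'_def)
    ultimately have "d' b = \<zero>"
      using B(2) unfolding lin_independent_def by blast
    then have "\<ominus> c = \<zero>" by (simp add: d'_def)
    then show "c = \<zero>"
      using R.minus_minus[OF c(1)] by simp
  next
    have "submodule {c \<odot>\<^bsub>M\<^esub> b \<oplus>\<^bsub>M\<^esub> z | c z. c \<in> carrier R \<and> z \<in> Z} R M"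
    proof (rule submodule_of_closed)
      show "\<zero>\<^bsub>M\<^esub> \<in> {c \<odot>\<^bsub>M\<^esub> b \<oplus>\<^bsub>M\<^esub> z | c z. c \<in> carrier R \<and> z \<in> Z}"
        using ZE(7) bM by (auto intro!: exI[of _ \<zero>] exI[of _ "\<zero>\<^bsub>M\<^esub>"])
    next
      fix x y assume "x \<in> {c \<odot>\<^bsub>M\<^esub> b \<oplus>\<^bsub>M\<^esub> z | c z. c \<in> carrier R \<and> z \<in> Z}"
        "y \<in> {c \<odot>\<^bsub>M\<^esub> b \<oplus>\<^bsub>M\<^esub> z | c z. c \<in> carrier R \<and> z \<in> Z}"
      then obtain c z c' z' where *: "c \<in> carrier R" "c' \<in> carrier R" "z \<in> Z" "z' \<in> Z"
        "x = c \<odot>\<^bsub>M\<^esub> b \<oplus>\<^bsub>M\<^esub> z" "y = c' \<odot>\<^bsub>M\<^esub> b \<oplus>\<^bsub>M\<^esub> z'" by auto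
      then have "x \<oplus>\<^bsub>M\<^esub> y = (c \<oplus> c') \<odot>\<^bsub>M\<^esub> b \<oplus>\<^bsub>M\<^esub> (z \<oplus>\<^bsub>M\<^esub> z')"
        using bM ZM by (simp add: smult_l_distr M.a_ac)
      then show "x \<oplus>\<^bsub>M\<^esub> y \<in> {c \<odot>\<^bsub>M\<^esub> b \<oplus>\<^bsub>M\<^esub> z | c z. c \<in> carrier R \<and> z \<in> Z}"
        using * ZE(5) by blast
    next
      fix a x assume a: "a \<in> carrier R" and "x \<in> {c \<odot>\<^bsub>M\<^esub> b \<oplus>\<^bsub>M\<^esub> z | c z. c \<in> carrier R \<and> z \<in> Z}"
      then obtain c z where *: "c \<in> carrier R" "z \<in> Z" "x = c \<odot>\<^bsub>M\<^esub> b \<oplus>\<^bsub>M\<^esub> z" by auto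
      then have "a \<odot>\<^bsub>M\<^esub> x = (a \<otimes> c) \<odot>\<^bsub>M\<^esub> b \<oplus>\<^bsub>M\<^esub> a \<odot>\<^bsub>M\<^esub> z"
        using bM ZM a by (simp add: smult_r_distr smult_assoc1)
      then show "a \<odot>\<^bsub>M\<^esub> x \<in> {c \<odot>\<^bsub>M\<^esub> b \<oplus>\<^bsub>M\<^esub> z | c z. c \<in> carrier R \<and> z \<in> Z}"
        using * ZE(4) a by blast
    qed (use bM ZM in auto)
    moreover have "B \<subseteq> {c \<odot>\<^bsub>M\<^esub> b \<oplus>\<^bsub>M\<^esub> z | c z. c \<in> carrier R \<and> z \<in> Z}"
    proof
      fix y assume y: "y \<in> B"
      show "y \<in> {c \<odot>\<^bsub>M\<^esub> b \<oplus>\<^bsub>M\<^esub> z | c z. c \<in> carrier R \<and> z \<in> Z}"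
      proof (cases "y = b")
        case True
        then have "y = \<one> \<odot>\<^bsub>M\<^esub> b \<oplus>\<^bsub>M\<^esub> \<zero>\<^bsub>M\<^esub>" using bM by simp
        then show ?thesis using ZE(7) by blast
      next
        case False
        then have "y \<in> Z"
          using lin_span_superset[of "B - {b}"] y B(1) by (auto simp: Z_def)
        moreover have "y = \<zero> \<odot>\<^bsub>M\<^esub> b \<oplus>\<^bsub>M\<^esub> y" using bM y B(1) by auto
        ultimately show ?thesis by blast
      qed
    qed
    ultimately have "carrier M \<subseteq> {c \<odot>\<^bsub>M\<^esub> b \<oplus>\<^bsub>M\<^esub> z | c z. c \<in> carrier R \<and> z \<in> Z}"
      using lin_span_least B(3) by blast
    then show "\<exists>c\<in>carrier R. \<exists>z\<in>Z. y = c \<odot>\<^bsub>M\<^esub> b \<oplus>\<^bsub>M\<^esub> z" if "y \<in> carrier M" for y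
      using that by blast
  qed
qed

text \<open>\<open>x0\<close> witnesses that the localised module is nonzero, so it has a basis
  element b, and m is a numerator of b. Elements of IM have their b-coordinate in the extension of I
  to \<open>RS\<close>; comparing with the coordinate of r m and clearing denominators gives the
  claim. As m is fixed before I, the same m serves every ideal, 0 included.\<close>

lemma (in localization) free_localization_coordinate:
  assumes free: "free_module RS MS"
    and x0: "x0 \<in> carrier M" "\<And>s. s \<in> S \<Longrightarrow> s \<odot>\<^bsub>M\<^esub> x0 \<noteq> \<zero>\<^bsub>M\<^esub>"
  obtains m where "m \<in> carrier M"
    "\<And>I r. \<lbrakk>ideal I R; r \<in> carrier R; r \<odot>\<^bsub>M\<^esub> m \<in> ideal_smult R I M\<rbrakk> \<Longrightarrow> \<exists>u\<in>S. u \<otimes> r \<in> I"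
proof -
  interpret L: module RS MS by (rule module_MS)
  have "mfrac x0 \<one> \<noteq> \<zero>\<^bsub>MS\<^esub>"
    using x0 one_S by (auto simp: zero_MS mfrac_eq_iff S_carrier)
  then have "carrier MS \<noteq> {\<zero>\<^bsub>MS\<^esub>}"
    using mfrac_closed[OF x0(1) one_S] by auto
  then obtain b Z where b: "b \<in> carrier MS" "submodule Z RS MS"
    and indep: "\<And>c. \<lbrakk>c \<in> carrier RS; c \<odot>\<^bsub>MS\<^esub> b \<in> Z\<rbrakk> \<Longrightarrow> c = \<zero>\<^bsub>RS\<^esub>"
    and span: "\<And>y. y \<in> carrier MS \<Longrightarrow> \<exists>c\<in>carrier RS. \<exists>z\<in>Z. y = c \<odot>\<^bsub>MS\<^esub> b \<oplus>\<^bsub>MS\<^esub> z"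
    using L.free_module_split[OF free] by metis
  note ZE = L.submoduleE[OF b(2)] L.submodule_zero_closed[OF b(2)]
  have ZM: "z \<in> carrier MS" if "z \<in> Z" for z using that ZE(1) by auto
  obtain m s where m: "m \<in> carrier M" "s \<in> S" "b = mfrac m s"
    using MS_cases[OF b(1)] .
  show thesis
  proof
    fix I r assume I: "ideal I R" and r: "r \<in> carrier R" "r \<odot>\<^bsub>M\<^esub> m \<in> ideal_smult R I M"
    note IE = ideal.Icarr[OF I] ideal.I_l_closed[OF I] additive_subgroup.a_closed[OF ideal.axioms(1)[OF I]]
      additive_subgroup.zero_closed[OF ideal.axioms(1)[OF I]] ideal.I_r_closed[OF I]
    \<comment> \<open>The elements of M whose image has a b-coordinate a/v with a in I.\<close>
    define W where "W = {y \<in> carrier M. \<exists>a\<in>I. \<exists>v\<in>S. \<exists>z\<in>Z. mfrac y \<one> = rfrac a v \<odot>\<^bsub>MS\<^esub> b \<oplus>\<^bsub>MS\<^esub> z}"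
    \<comment> \<open>Linearity of the coordinate. It is used with c in I for closure of W under
      scalars, and with a in I for the products a x.\<close>
    have smult: "mfrac (a \<odot>\<^bsub>M\<^esub> y) \<one> = rfrac (a \<otimes> c) v \<odot>\<^bsub>MS\<^esub> b \<oplus>\<^bsub>MS\<^esub> rfrac a \<one> \<odot>\<^bsub>MS\<^esub> z"
        "rfrac a \<one> \<odot>\<^bsub>MS\<^esub> z \<in> Z"
      if "a \<in> carrier R" "y \<in> carrier M" "c \<in> carrier R" "v \<in> S" "z \<in> Z"
        "mfrac y \<one> = rfrac c v \<odot>\<^bsub>MS\<^esub> b \<oplus>\<^bsub>MS\<^esub> z" for a y c v z
    proof -
      have "mfrac (a \<odot>\<^bsub>M\<^esub> y) \<one> = rfrac a \<one> \<odot>\<^bsub>MS\<^esub> mfrac y \<one>"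
        using that(1,2) one_S by (simp add: rfrac_smult_mfrac)
      also have "\<dots> = (rfrac a \<one> \<otimes>\<^bsub>RS\<^esub> rfrac c v) \<odot>\<^bsub>MS\<^esub> b \<oplus>\<^bsub>MS\<^esub> rfrac a \<one> \<odot>\<^bsub>MS\<^esub> z"
        using that b(1) one_S ZM by (simp add: L.smult_r_distr L.smult_assoc1 rfrac_closed)
      finally show "mfrac (a \<odot>\<^bsub>M\<^esub> y) \<one> = rfrac (a \<otimes> c) v \<odot>\<^bsub>MS\<^esub> b \<oplus>\<^bsub>MS\<^esub> rfrac a \<one> \<odot>\<^bsub>MS\<^esub> z"
        using that one_S by (simp add: rfrac_mult S_carrier)
      show "rfrac a \<one> \<odot>\<^bsub>MS\<^esub> z \<in> Z"
        by (rule ZE(4)[OF rfrac_closed]) (use that one_S in auto)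
    qed
    have "ideal_smult R I M \<subseteq> W"
    proof (rule ideal_smult_least[OF submodule_of_closed])
      show "W \<subseteq> carrier M" by (auto simp: W_def)
      have "rfrac \<zero> \<one> \<odot>\<^bsub>MS\<^esub> b = \<zero>\<^bsub>MS\<^esub>"
        using m one_S by (simp add: rfrac_smult_mfrac mfrac_zero S_carrier)
      then have "mfrac \<zero>\<^bsub>M\<^esub> \<one> = rfrac \<zero> \<one> \<odot>\<^bsub>MS\<^esub> b \<oplus>\<^bsub>MS\<^esub> \<zero>\<^bsub>MS\<^esub>"
        using L.M.zero_closed L.M.r_zero by (simp add: zero_MS)
      then show "\<zero>\<^bsub>M\<^esub> \<in> W"
        unfolding W_def using IE(4) one_S ZE(7) by blast
    next
      fix x y assume "x \<in> W" "y \<in> W"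
      then obtain a v z a' v' z' where *: "x \<in> carrier M" "y \<in> carrier M" "a \<in> I" "v \<in> S" "z \<in> Z"
        "a' \<in> I" "v' \<in> S" "z' \<in> Z" "mfrac x \<one> = rfrac a v \<odot>\<^bsub>MS\<^esub> b \<oplus>\<^bsub>MS\<^esub> z"
        "mfrac y \<one> = rfrac a' v' \<odot>\<^bsub>MS\<^esub> b \<oplus>\<^bsub>MS\<^esub> z'"
        unfolding W_def by blast
      have "mfrac (x \<oplus>\<^bsub>M\<^esub> y) \<one> = mfrac x \<one> \<oplus>\<^bsub>MS\<^esub> mfrac y \<one>"
        using *(1,2) one_S by (simp add: mfrac_add)
      also have "\<dots> = (rfrac a v \<oplus>\<^bsub>RS\<^esub> rfrac a' v') \<odot>\<^bsub>MS\<^esub> b \<oplus>\<^bsub>MS\<^esub> (z \<oplus>\<^bsub>MS\<^esub> z')"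
        using * b(1) ZM IE(1) by (simp add: L.smult_l_distr L.M.a_ac rfrac_closed)
      also have "rfrac a v \<oplus>\<^bsub>RS\<^esub> rfrac a' v' = rfrac (v' \<otimes> a \<oplus> v \<otimes> a') (v \<otimes> v')"
        using * IE(1) by (simp add: rfrac_add)
      finally have "mfrac (x \<oplus>\<^bsub>M\<^esub> y) \<one>
          = rfrac (v' \<otimes> a \<oplus> v \<otimes> a') (v \<otimes> v') \<odot>\<^bsub>MS\<^esub> b \<oplus>\<^bsub>MS\<^esub> (z \<oplus>\<^bsub>MS\<^esub> z')" .
      moreover have "v' \<otimes> a \<oplus> v \<otimes> a' \<in> I" "v \<otimes> v' \<in> S" "z \<oplus>\<^bsub>MS\<^esub> z' \<in> Z"
        using * IE(2,3) S_carrier mult_S ZE(5) by simp_all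
      ultimately show "x \<oplus>\<^bsub>M\<^esub> y \<in> W"
        unfolding W_def using *(1,2) by blast
    next
      fix a x assume a: "a \<in> carrier R" and "x \<in> W"
      then obtain c v z where *: "x \<in> carrier M" "c \<in> I" "v \<in> S" "z \<in> Z"
        "mfrac x \<one> = rfrac c v \<odot>\<^bsub>MS\<^esub> b \<oplus>\<^bsub>MS\<^esub> z"
        unfolding W_def by blast
      show "a \<odot>\<^bsub>M\<^esub> x \<in> W"
        unfolding W_def using smult[OF a *(1) IE(1)[OF *(2)] *(3-5)] IE(2)[OF *(2) a] *(1,3) a by blast
    next
      fix a x assume a: "a \<in> I" and x: "x \<in> carrier M"
      obtain p z where p: "p \<in> carrier RS" "z \<in> Z" "mfrac x \<one> = p \<odot>\<^bsub>MS\<^esub> b \<oplus>\<^bsub>MS\<^esub> z"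
        using span[OF mfrac_closed[OF x one_S]] by blast
      obtain c v where c: "c \<in> carrier R" "v \<in> S" "p = rfrac c v"
        using RS_cases[OF p(1)] .
      show "a \<odot>\<^bsub>M\<^esub> x \<in> W"
        unfolding W_def using smult[OF IE(1)[OF a] x c(1,2) p(2)] IE(5)[OF a c(1)] IE(1)[OF a] c x p by blast
    qed
    then obtain a v z where a: "a \<in> I" "v \<in> S" "z \<in> Z" "mfrac (r \<odot>\<^bsub>M\<^esub> m) \<one> = rfrac a v \<odot>\<^bsub>MS\<^esub> b \<oplus>\<^bsub>MS\<^esub> z"
      using r unfolding W_def by blast
    have sR: "s \<in> carrier R" "v \<in> carrier R" "a \<in> carrier R" using m a S_carrier IE(1) by auto
    \<comment> \<open>Since b = m/s, the element m/1 is s b, and r m has coordinate r s.\<close>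
    have "mfrac (r \<odot>\<^bsub>M\<^esub> m) \<one> = mfrac (s \<odot>\<^bsub>M\<^esub> (r \<odot>\<^bsub>M\<^esub> m)) (s \<otimes> \<one>)"
      using m r one_S by (simp add: mfrac_cancel del: r_one)
    also have "\<dots> = rfrac (r \<otimes> s) \<one> \<odot>\<^bsub>MS\<^esub> b"
      using m r sR one_S by (simp add: rfrac_smult_mfrac smult_assoc1[symmetric] m_comm)
    finally have rs: "rfrac (r \<otimes> s) \<one> \<odot>\<^bsub>MS\<^esub> b = rfrac a v \<odot>\<^bsub>MS\<^esub> b \<oplus>\<^bsub>MS\<^esub> z"
      using a(4) by simp
    have cl: "rfrac (r \<otimes> s) \<one> \<in> carrier RS" "rfrac a v \<in> carrier RS"
      using r sR a one_S by (simp_all add: rfrac_closed)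
    \<comment> \<open>The difference of the two coordinates of r m sends b into Z, hence is
      0.\<close>
    have "(rfrac (r \<otimes> s) \<one> \<ominus>\<^bsub>RS\<^esub> rfrac a v) \<odot>\<^bsub>MS\<^esub> b
        = (rfrac a v \<odot>\<^bsub>MS\<^esub> b \<oplus>\<^bsub>MS\<^esub> z) \<oplus>\<^bsub>MS\<^esub> \<ominus>\<^bsub>MS\<^esub> (rfrac a v \<odot>\<^bsub>MS\<^esub> b)"
      using cl b(1) by (simp add: L.R.minus_eq L.smult_l_distr L.smult_l_minus rs)
    also have "\<dots> = z"
      using cl b(1) ZM[OF a(3)] by (simp add: L.M.a_ac L.M.r_neg2 L.M.r_neg1 L.M.r_neg)
    finally have "rfrac (r \<otimes> s) \<one> \<ominus>\<^bsub>RS\<^esub> rfrac a v = \<zero>\<^bsub>RS\<^esub>"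
      using indep cl a(3) by simp
    then have "rfrac (r \<otimes> s) \<one> = rfrac a v"
      using cl by simp
    then obtain u where u: "u \<in> S" "u \<otimes> v \<otimes> (r \<otimes> s) = u \<otimes> \<one> \<otimes> a"
      using r sR a(2) one_S by (subst (asm) rfrac_eq_iff) auto
    then have "(u \<otimes> v \<otimes> s) \<otimes> r = u \<otimes> a"
      using r sR S_carrier by (simp add: m_ac)
    also have "\<dots> \<in> I" using IE(2) a(1) u(1) S_carrier by simp
    finally show "\<exists>u\<in>S. u \<otimes> r \<in> I"
      using mult_S u(1) a(2) m(2) by blast
  qed (rule m(1))
qed

section \<open>Locally free modules over Laskerian rings\<close>

lemma (in cring) proper_ideal_subset_prime:
  assumes "ideal I R" "I \<noteq> carrier R"
  obtains P where "primeideal P R" "I \<subseteq> P"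
proof -
  \<comment> \<open>Properness is expressed by excluding 1, a condition that passes to unions of
    chains.\<close>
  define F where "F = {J. ideal J R \<and> I \<subseteq> J \<and> \<one> \<notin> J}"
  have "I \<in> F"
    using assms ideal.one_imp_carrier by (auto simp: F_def)
  have "\<exists>P\<in>F. \<forall>J\<in>F. P \<subseteq> J \<longrightarrow> J = P"
  proof (rule subset_Zorn_nonempty)
    show "F \<noteq> {}" using \<open>I \<in> F\<close> by auto
    fix C assume C: "C \<noteq> {}" "subset.chain F C"
    have "subset.chain {J. ideal J R} C"
      using C(2) by (auto simp: pred_on.chain_def F_def)
    then have "ideal (\<Union>C) R"
      using chain_Union_is_ideal[of C] C(1) by simp
    then show "\<Union>C \<in> F"
      using C by (auto simp: F_def pred_on.chain_def)
  qed
  then obtain P where P: "P \<in> F" "\<And>J. J \<in> F \<Longrightarrow> P \<subseteq> J \<Longrightarrow> J = P" by blast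
  have "maximalideal P R"
  proof (rule maximalidealI)
    show "ideal P R" "carrier R \<noteq> P" using P(1) by (auto simp: F_def)
    fix J assume J: "ideal J R" "P \<subseteq> J"
    then show "J = P \<or> J = carrier R"
      using P ideal.one_imp_carrier[OF J(1)] by (auto simp: F_def)
  qed
  then show thesis
    using that[OF maximalideal_prime] P(1) by (auto simp: F_def)
qed

section \<open>Primary ideals and their radicals\<close>

definition primary_ideal :: "('a, 'm) ring_scheme \<Rightarrow> 'a set \<Rightarrow> bool" where
  "primary_ideal R Q \<longleftrightarrow> ideal Q R \<and> Q \<noteq> carrier R \<and>
     (\<forall>r \<in> carrier R. \<forall>x \<in> carrier R. r \<otimes>\<^bsub>R\<^esub> x \<in> Q \<longrightarrow> x \<in> Q \<or> (\<exists>n::nat. r [^]\<^bsub>R\<^esub> n \<in> Q))"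

definition ideal_radical :: "('a, 'm) ring_scheme \<Rightarrow> 'a set \<Rightarrow> 'a set" where
  "ideal_radical R Q = {r \<in> carrier R. \<exists>n::nat. r [^]\<^bsub>R\<^esub> n \<in> Q}"

lemma (in cring) submodule_self_module_iff: "submodule H R (self_module R) \<longleftrightarrow> ideal H R"
proof
  interpret S: module R "self_module R" by (rule module_self_module)
  assume "submodule H R (self_module R)"
  note E = S.submoduleE[OF this] S.submodule_zero_closed[OF this]
  show "ideal H R"
    by (rule ideal_of_closed) (use E in \<open>auto simp: self_module_def\<close>)
next
  interpret S: module R "self_module R" by (rule module_self_module)
  assume I: "ideal H R"
  show "submodule H R (self_module R)"
    by (rule S.submodule_of_closed)
      (use ideal.Icarr[OF I] additive_subgroup.zero_closed[OF ideal.axioms(1)[OF I]]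
        additive_subgroup.a_closed[OF ideal.axioms(1)[OF I]] ideal.I_l_closed[OF I]
        in \<open>auto simp: self_module_def\<close>)
qed

lemma (in cring) residual_self_module:
  assumes "ideal Q R"
  shows "residual R (self_module R) Q = Q"
proof
  show "residual R (self_module R) Q \<subseteq> Q"
    using one_closed by (fastforce simp: residual_def self_module_def dest: bspec[of _ _ \<one>])
  show "Q \<subseteq> residual R (self_module R) Q"
    using ideal.Icarr[OF assms] ideal.I_r_closed[OF assms] by (auto simp: residual_def self_module_def)
qed

lemma (in cring) primary_decomposition_ideal:
  assumes "laskerian_ring R" "ideal I R" "I \<noteq> carrier R"
  obtains \<Q> where "finite \<Q>" "\<Q> \<noteq> {}" "\<And>Q. Q \<in> \<Q> \<Longrightarrow> primary_ideal R Q" "I = \<Inter>\<Q>"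
proof -
  have carr: "carrier (self_module R) = carrier R" by (simp add: self_module_def)
  have "has_primary_decomposition R (self_module R) I"
    using assms by (simp add: laskerian_ring_def laskerian_module_def submodule_self_module_iff carr)
  then obtain \<Q> where \<Q>: "finite \<Q>" "\<Q> \<noteq> {}" "I = \<Inter>\<Q>"
    "\<And>Q. Q \<in> \<Q> \<Longrightarrow> primary_submodule R (self_module R) Q"
    by (auto simp: has_primary_decomposition_def)
  have "primary_ideal R Q" if "Q \<in> \<Q>" for Q
  proof -
    have Q: "primary_submodule R (self_module R) Q" using \<Q>(4)[OF that] .
    then have iQ: "ideal Q R" by (simp add: primary_submodule_def submodule_self_module_iff)
    show ?thesis
      using Q iQ unfolding primary_submodule_def primary_ideal_def residual_self_module[OF iQ]
      by (simp add: self_module_def)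
  qed
  with \<Q> that show thesis by metis
qed

text \<open>For primary Q, the radical consists of the r that kill some nonzero class of R/Q:
  \<open>prim\<close> gives one direction, and \<open>kill\<close> the other, even inside the
  multiples of any nonzero class. This description replaces binomial expansions.\<close>

lemma (in cring) primary_ideal_radical:
  assumes "primary_ideal R Q"
  shows "Q \<subseteq> ideal_radical R Q" "primeideal (ideal_radical R Q) R"
    and "\<lbrakk>s \<in> carrier R - ideal_radical R Q; x \<in> carrier R; s \<otimes> x \<in> Q\<rbrakk> \<Longrightarrow> x \<in> Q"
    and "\<lbrakk>primeideal P R; Q \<subseteq> P\<rbrakk> \<Longrightarrow> ideal_radical R Q \<subseteq> P"
proof -
  have Q: "ideal Q R" "Q \<noteq> carrier R" using assms by (auto simp: primary_ideal_def)
  note QE = ideal.Icarr[OF Q(1)] ideal.I_l_closed[OF Q(1)] ideal.I_r_closed[OF Q(1)]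
    additive_subgroup.a_closed[OF ideal.axioms(1)[OF Q(1)]]
    additive_subgroup.zero_closed[OF ideal.axioms(1)[OF Q(1)]]
  let ?P = "ideal_radical R Q"
  have one: "\<one> \<notin> Q" using Q ideal.one_imp_carrier by auto
  have prim: "r \<in> ?P" if "r \<in> carrier R" "x \<in> carrier R" "r \<otimes> x \<in> Q" "x \<notin> Q" for r x
    using assms that unfolding primary_ideal_def ideal_radical_def by blast
  show QP: "Q \<subseteq> ?P"
  proof
    fix q assume "q \<in> Q"
    then show "q \<in> ?P"
      using QE(1) by (auto simp: ideal_radical_def intro!: exI[of _ 1])
  qed
  show "\<lbrakk>s \<in> carrier R - ?P; x \<in> carrier R; s \<otimes> x \<in> Q\<rbrakk> \<Longrightarrow> x \<in> Q"
    using prim by blast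
  have kill: "\<exists>y\<in>carrier R. r \<otimes> (y \<otimes> x) \<in> Q \<and> y \<otimes> x \<notin> Q"
    if r: "r \<in> ?P" and x: "x \<in> carrier R" "x \<notin> Q" for r x
  proof -
    have rR: "r \<in> carrier R" using r by (simp add: ideal_radical_def)
    obtain n :: nat where "r [^] n \<in> Q" using r by (auto simp: ideal_radical_def)
    then have ex: "r [^] n \<otimes> x \<in> Q" using QE(3) x by simp
    \<comment> \<open>The last power of r that does not yet kill x modulo Q supplies y.\<close>
    define k where "k = (LEAST k::nat. r [^] k \<otimes> x \<in> Q)"
    have k: "r [^] k \<otimes> x \<in> Q" unfolding k_def using ex by (rule LeastI)
    then have "k \<noteq> 0" using x by (cases k) auto
    then obtain j where j: "k = Suc j" by (cases k) auto
    then have "r [^] j \<otimes> x \<notin> Q"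
      using not_less_Least[of j "\<lambda>k. r [^] k \<otimes> x \<in> Q"] k_def by simp
    moreover have "r \<otimes> (r [^] j \<otimes> x) \<in> Q"
      using k rR x by (simp add: j m_ac)
    ultimately show ?thesis using rR by blast
  qed
  have idl: "ideal ?P R"
  proof (rule ideal_of_closed)
    show "?P \<subseteq> carrier R" by (auto simp: ideal_radical_def)
    show "\<zero> \<in> ?P" using QP QE(5) by auto
  next
    fix a b assume a: "a \<in> ?P" and b: "b \<in> ?P"
    have ab: "a \<in> carrier R" "b \<in> carrier R" using a b by (auto simp: ideal_radical_def)
    \<comment> \<open>y is nonzero modulo Q and killed by a; z is then chosen so that z y stays
      nonzero and is also killed by b, hence by a + b.\<close>
    obtain y where y: "y \<in> carrier R" "a \<otimes> (y \<otimes> \<one>) \<in> Q" "y \<otimes> \<one> \<notin> Q"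
      using kill[OF a one_closed one] by blast
    obtain z where z: "z \<in> carrier R" "b \<otimes> (z \<otimes> y) \<in> Q" "z \<otimes> y \<notin> Q"
      using kill[OF b, of y] y by auto
    have "a \<otimes> (z \<otimes> y) = z \<otimes> (a \<otimes> (y \<otimes> \<one>))" using ab y(1) z(1) by (simp add: m_ac)
    then have "(a \<oplus> b) \<otimes> (z \<otimes> y) \<in> Q"
      using QE(2,4) ab y z by (simp add: l_distr)
    then show "a \<oplus> b \<in> ?P"
      using prim[of "a \<oplus> b" "z \<otimes> y"] ab y z by simp
  next
    fix a x assume a: "a \<in> ?P" and x: "x \<in> carrier R"
    then obtain y where "a \<in> carrier R" "y \<in> carrier R" "a \<otimes> (y \<otimes> \<one>) \<in> Q" "y \<otimes> \<one> \<notin> Q"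
      using kill[OF a one_closed one] by (auto simp: ideal_radical_def)
    then show "x \<otimes> a \<in> ?P"
      using prim[of "x \<otimes> a" y] QE(2) x by (simp add: m_assoc)
  qed
  show "primeideal ?P R"
  proof (rule primeidealI[OF idl is_cring])
    have "\<one> \<notin> ?P" using one by (simp add: ideal_radical_def)
    then show "carrier R \<noteq> ?P" by auto
    fix a b assume ab: "a \<in> carrier R" "b \<in> carrier R" "a \<otimes> b \<in> ?P"
    then obtain y where y: "y \<in> carrier R" "(a \<otimes> b) \<otimes> y \<in> Q" "y \<notin> Q"
      using kill[OF ab(3) one_closed one] by auto
    show "a \<in> ?P \<or> b \<in> ?P"
    \<comment> \<open>The nonzero class of y is killed by a b: either b kills it already, or a kills
      the nonzero class of b y.\<close>
    proof (cases "b \<otimes> y \<in> Q")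
      case True
      then show ?thesis using prim ab y by blast
    next
      case False
      then show ?thesis using prim[of a "b \<otimes> y"] ab y by (simp add: m_assoc)
    qed
  qed
  show "?P \<subseteq> P" if P: "primeideal P R" "Q \<subseteq> P"
  proof
    interpret P: primeideal P R by fact
    fix r assume "r \<in> ?P"
    then obtain n :: nat where r: "r \<in> carrier R" "r [^] n \<in> P"
      using P(2) by (auto simp: ideal_radical_def)
    from r(2) show "r \<in> P"
    proof (induction n)
      case 0
      then show ?case using P.one_imp_carrier P.I_notcarr by simp
    next
      case (Suc n)
      then show ?case using P.I_prime[of "r [^] n" r] r(1) by auto
    qed
  qed
qed

text \<open>s is a product of elements of Q - P, one for each Q, and 1 for the empty family. In
  contrapositive form, a prime that contains a finite intersection of ideals contains one of
  them.\<close>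

lemma (in cring) avoid_prime:
  assumes "primeideal P R" "finite \<Q>" "\<And>Q. Q \<in> \<Q> \<Longrightarrow> ideal Q R \<and> \<not> Q \<subseteq> P"
  shows "\<exists>s\<in>carrier R - P. \<forall>Q\<in>\<Q>. s \<in> Q"
proof -
  interpret P: primeideal P R by fact
  show ?thesis
    using assms(2,3)
  proof (induction \<Q>)
    case empty
    then show ?case using P.one_imp_carrier P.I_notcarr by auto
  next
    case (insert Q \<Q>)
    then obtain s where s: "s \<in> carrier R - P" "\<forall>Q\<in>\<Q>. s \<in> Q" by auto
    obtain q where q: "q \<in> Q" "q \<notin> P" using insert.prems by auto
    have Q: "ideal Q R" using insert.prems by auto
    have qR: "q \<in> carrier R" by (rule ideal.Icarr[OF Q q(1)])
    have "s \<otimes> q \<in> carrier R - P" using s q qR P.I_prime by auto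
    moreover have "s \<otimes> q \<in> Q" using ideal.I_l_closed[OF Q q(1)] s by simp
    moreover have "s \<otimes> q \<in> Q'" if "Q' \<in> \<Q>" for Q'
      using ideal.I_r_closed[of Q' R s q] insert.prems s qR that by auto
    ultimately show ?case by blast
  qed
qed

section \<open>The support of a locally free module\<close>

lemma (in module) localization_prime:
  assumes "primeideal P R"
  shows "localization R M (carrier R - P)"
proof -
  interpret P: primeideal P R by fact
  show ?thesis
    by (intro localization.intro module_axioms localization_axioms.intro)
      (use P.one_imp_carrier P.I_notcarr P.I_prime in auto)
qed

text \<open>The localisation of \<open>M\<close> at \<open>P\<close> is nonzero.\<close>

definition in_support :: "('a, 'm) ring_scheme \<Rightarrow> ('a, 'b, 'n) module_scheme \<Rightarrow> 'a set \<Rightarrow> bool" where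
  "in_support R M P \<longleftrightarrow> (\<exists>x\<in>carrier M. \<forall>s\<in>carrier R - P. s \<odot>\<^bsub>M\<^esub> x \<noteq> \<zero>\<^bsub>M\<^esub>)"

context module
begin

lemma in_support_mono:
  "\<lbrakk>in_support R M P; P \<subseteq> P'\<rbrakk> \<Longrightarrow> in_support R M P'"
  unfolding in_support_def by blast

lemma locally_free_coordinate:
  assumes "locally_free R M" "primeideal P R" "in_support R M P"
  obtains m where "m \<in> carrier M"
    "\<And>I r. \<lbrakk>ideal I R; r \<in> carrier R; r \<odot>\<^bsub>M\<^esub> m \<in> ideal_smult R I M\<rbrakk> \<Longrightarrow> \<exists>u\<in>carrier R - P. u \<otimes> r \<in> I"
proof -
  interpret L: localization R M "carrier R - P" by (rule localization_prime[OF assms(2)])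
  obtain x where "x \<in> carrier M" "\<And>s. s \<in> carrier R - P \<Longrightarrow> s \<odot>\<^bsub>M\<^esub> x \<noteq> \<zero>\<^bsub>M\<^esub>"
    using assms(3) unfolding in_support_def by blast
  then show thesis
    using L.free_localization_coordinate[of x] assms(1,2) that unfolding locally_free_def by metis
qed

text \<open>The case I = 0: the annihilator of m, and so that of M, vanishes after localising at
  P.\<close>

lemma locally_free_annihilator:
  assumes "locally_free R M" "primeideal P R" "in_support R M P"
  obtains m where "m \<in> carrier M"
    "\<And>r. \<lbrakk>r \<in> carrier R; r \<odot>\<^bsub>M\<^esub> m = \<zero>\<^bsub>M\<^esub>\<rbrakk> \<Longrightarrow> \<exists>u\<in>carrier R - P. u \<otimes> r = \<zero>"
proof -
  obtain m where m: "m \<in> carrier M"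
    "\<And>I r. \<lbrakk>ideal I R; r \<in> carrier R; r \<odot>\<^bsub>M\<^esub> m \<in> ideal_smult R I M\<rbrakk> \<Longrightarrow> \<exists>u\<in>carrier R - P. u \<otimes> r \<in> I"
    using locally_free_coordinate[OF assms] by blast
  have "\<zero>\<^bsub>M\<^esub> \<in> ideal_smult R {\<zero>} M"
    by (rule submodule_zero_closed[OF submodule_ideal_smult]) auto
  then show thesis
    using that[OF m(1)] m(2)[OF zeroideal] by simp
qed

text \<open>Passing to a smaller prime is where freeness enters: if s outside P' killed m, then u s
  = 0 \<in> P' for some u outside P, hence outside P', against primality of P'.\<close>

lemma in_support_generalization:
  assumes "locally_free R M" "primeideal P R" "in_support R M P" "primeideal P' R" "P' \<subseteq> P"
  shows "in_support R M P'"
proof -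
  interpret P': primeideal P' R by fact
  obtain m where m: "m \<in> carrier M"
    "\<And>r. \<lbrakk>r \<in> carrier R; r \<odot>\<^bsub>M\<^esub> m = \<zero>\<^bsub>M\<^esub>\<rbrakk> \<Longrightarrow> \<exists>u\<in>carrier R - P. u \<otimes> r = \<zero>"
    using locally_free_annihilator[OF assms(1-3)] by blast
  have False if s: "s \<in> carrier R - P'" "s \<odot>\<^bsub>M\<^esub> m = \<zero>\<^bsub>M\<^esub>" for s
  proof -
    obtain u where u: "u \<in> carrier R - P" "u \<otimes> s = \<zero>" using m(2) s by blast
    then have "u \<otimes> s \<in> P'" using P'.zero_closed by simp
    then show False using P'.I_prime[of u s] u s assms(5) by blast
  qed
  then show ?thesis using m(1) unfolding in_support_def by blast
qed

text \<open>\<open>G\<close> collects the components of 0 whose radical is in the support. Their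
  intersection annihilates M, which is checked at a prime above the annihilator of a would-be
  nonzero b x; so this intersection lies in P.\<close>

lemma laskerian_in_support:
  assumes "laskerian_ring R" "locally_free R M" "\<one> \<noteq> \<zero>" "primeideal P R" "annihilator R M \<subseteq> P"
  shows "in_support R M P"
proof -
  have "\<one> \<notin> {\<zero>}" using assms(3) by simp
  then have "{\<zero>} \<noteq> carrier R" by blast
  then obtain \<Q> where \<Q>: "finite \<Q>" "\<Q> \<noteq> {}" "\<And>Q. Q \<in> \<Q> \<Longrightarrow> primary_ideal R Q" "{\<zero>} = \<Inter>\<Q>"
    using primary_decomposition_ideal[OF assms(1) zeroideal] by blast
  have idl: "ideal Q R" if "Q \<in> \<Q>" for Q using \<Q>(3)[OF that] by (simp add: primary_ideal_def)
  define G where "G = {Q \<in> \<Q>. in_support R M (ideal_radical R Q)}"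
  have "b \<in> annihilator R M" if b: "b \<in> carrier R" "\<forall>Q\<in>G. b \<in> Q" for b
  proof -
    have "b \<odot>\<^bsub>M\<^esub> x = \<zero>\<^bsub>M\<^esub>" if x: "x \<in> carrier M" for x
    proof (rule ccontr)
      assume nz: "b \<odot>\<^bsub>M\<^esub> x \<noteq> \<zero>\<^bsub>M\<^esub>"
      define A where "A = {r \<in> carrier R. r \<odot>\<^bsub>M\<^esub> (b \<odot>\<^bsub>M\<^esub> x) = \<zero>\<^bsub>M\<^esub>}"
      have "ideal A R"
        by (rule ideal_of_closed) (use b x in \<open>auto simp: A_def smult_l_distr smult_assoc1\<close>)
      moreover have "\<one> \<notin> A" using nz b x by (simp add: A_def)
      ultimately obtain N where N: "primeideal N R" "A \<subseteq> N"
        using proper_ideal_subset_prime[of A] by blast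
      interpret N: primeideal N R by fact
      have nA: "s \<notin> A" if "s \<in> carrier R - N" for s using N(2) that by blast
      show False
      proof (cases "in_support R M N")
        case True
        \<comment> \<open>A component inside N has its radical inside N, hence in the support and in
          \<open>G\<close>. The components outside \<open>G\<close> can therefore be met by a single
          s outside N; then s b lies in every component of 0, so s b = 0.\<close>
        have "ideal Q R \<and> \<not> Q \<subseteq> N" if Q: "Q \<in> \<Q> - G" for Q
        proof -
          have pQ: "primary_ideal R Q" using Q \<Q>(3) by blast
          have "Q \<subseteq> N \<Longrightarrow> Q \<in> G"
            using in_support_generalization[OF assms(2) N(1) True primary_ideal_radical(2)[OF pQ]]
              primary_ideal_radical(4)[OF pQ N(1)] Q by (simp add: G_def)
          then show ?thesis using Q idl by blast
        qed
        then obtain s where s: "s \<in> carrier R - N" "\<forall>Q\<in>\<Q> - G. s \<in> Q"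
          using avoid_prime[OF N(1), of "\<Q> - G"] \<Q>(1) by blast
        have "s \<otimes> b \<in> Q" if "Q \<in> \<Q>" for Q
          using ideal.I_l_closed[OF idl[OF that]] ideal.I_r_closed[OF idl[OF that]] s b that by blast
        then have "s \<otimes> b = \<zero>" using \<Q>(4) by blast
        then have "s \<in> A" using s(1) b(1) x by (simp add: A_def smult_assoc1[symmetric])
        then show False using nA s(1) by blast
      next
        case False
        then obtain s where s: "s \<in> carrier R - N" "s \<odot>\<^bsub>M\<^esub> x = \<zero>\<^bsub>M\<^esub>"
          using x unfolding in_support_def by blast
        have "s \<odot>\<^bsub>M\<^esub> (b \<odot>\<^bsub>M\<^esub> x) = b \<odot>\<^bsub>M\<^esub> (s \<odot>\<^bsub>M\<^esub> x)"
          using s(1) b(1) x by (simp add: smult_assoc1[symmetric] m_comm)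
        then have "s \<in> A" using s b(1) by (simp add: A_def)
        then show False using nA s(1) by blast
      qed
    qed
    then show ?thesis using b(1) by (simp add: annihilator_def residual_def)
  qed
  moreover have "finite G" using \<Q>(1) by (simp add: G_def)
  \<comment> \<open>Otherwise some b outside P lies in every member of \<open>G\<close>, hence in
    Ann(M) \<subseteq> P. An empty \<open>G\<close> is refuted in the same way.\<close>
  ultimately have "\<exists>Q\<in>G. Q \<subseteq> P"
    using avoid_prime[OF assms(4), of G] idl assms(5) unfolding G_def by blast
  then obtain Q where Q: "Q \<in> \<Q>" "in_support R M (ideal_radical R Q)" "Q \<subseteq> P"
    by (auto simp: G_def)
  show ?thesis
    by (rule in_support_mono[OF Q(2) primary_ideal_radical(4)[OF \<Q>(3)[OF Q(1)] assms(4) Q(3)]])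
qed

lemma quasi_primeful_locally_free:
  assumes "laskerian_ring R" "locally_free R M" "\<one> \<noteq> \<zero>"
  shows "quasi_primeful R M"
proof (rule quasi_primefulI)
  let ?K = "annihilator R M"
  note K = ideal_annihilator
  fix I assume I: "ideal I R" "I \<noteq> carrier R" "?K \<subseteq> I"
    and prime: "\<And>A B. \<lbrakk>ideal A R; ideal B R; ?K \<subseteq> A; ?K \<subseteq> B; A \<inter> B \<subseteq> I\<rbrakk> \<Longrightarrow> A \<subseteq> I \<or> B \<subseteq> I"
  obtain \<Q> where \<Q>: "finite \<Q>" "\<Q> \<noteq> {}" "\<And>Q. Q \<in> \<Q> \<Longrightarrow> primary_ideal R Q" "I = \<Inter>\<Q>"
    using primary_decomposition_ideal[OF assms(1) I(1,2)] by blast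
  \<comment> \<open>The condition on pairs of ideals above Ann(M) extends to finite families. The
    components of I contain I and so Ann(M); one of them is then contained in I, hence equal to
    it.\<close>
  have "\<exists>Q\<in>\<Q>'. Q \<subseteq> I" if "finite \<Q>'" "\<Q>' \<noteq> {}" "\<And>Q. Q \<in> \<Q>' \<Longrightarrow> ideal Q R \<and> ?K \<subseteq> Q" "\<Inter>\<Q>' \<subseteq> I" for \<Q>'
    using that
  proof (induction \<Q>' rule: finite_ne_induct)
    case (insert Q F)
    have "ideal (\<Inter>F) R"
      by (rule i_Intersect) (use insert in auto)
    then have "Q \<subseteq> I \<or> \<Inter>F \<subseteq> I"
      using prime[of Q "\<Inter>F"] insert.prems by auto
    then show ?case using insert by blast
  qed auto
  from this[OF \<Q>(1,2)] obtain Q where "Q \<in> \<Q>" "Q \<subseteq> I"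
    using \<Q>(3,4) I(3) unfolding primary_ideal_def by blast
  then have "I = Q" using \<Q>(4) by blast
  then have prim: "primary_ideal R I" using \<Q>(3) \<open>Q \<in> \<Q>\<close> by simp
  define P where "P = ideal_radical R I"
  note rad = primary_ideal_radical[OF prim, folded P_def]
  have supp: "in_support R M P"
    by (rule laskerian_in_support[OF assms rad(2)]) (use I(3) rad(1) in blast)
  obtain m where m: "m \<in> carrier M"
    "\<And>J r. \<lbrakk>ideal J R; r \<in> carrier R; r \<odot>\<^bsub>M\<^esub> m \<in> ideal_smult R J M\<rbrakk> \<Longrightarrow> \<exists>u\<in>carrier R - P. u \<otimes> r \<in> J"
    using locally_free_coordinate[OF assms(2) rad(2) supp] by blast
  \<comment> \<open>From r m \<in> IM one gets u r \<in> I with u outside P, and u is cancelled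
    because I is P-primary.\<close>
  have "residual R M (ideal_smult R I M) \<subseteq> I"
    using m rad(3) I(1) unfolding residual_def by blast
  moreover have "quasi_prime_ideal R I"
  proof (rule quasi_prime_ideal_lift[OF I(1,2) K prime])
    fix A B assume A: "ideal A R" and B: "ideal B R" and AB: "A \<inter> B \<subseteq> I"
    note AE = ideal.Icarr[OF A] ideal.I_l_closed[OF A]
    note BE = ideal.Icarr[OF B] ideal.I_l_closed[OF B]
    have ann: "\<exists>u\<in>carrier R - P. u \<otimes> k = \<zero>" if k: "k \<in> ?K" for k
      using locally_free_annihilator[OF assms(2) rad(2) supp] k
      by (metis (no_types, lifting) annihilator_def residual_def mem_Collect_eq singletonD)
    interpret P: primeideal P R by (rule rad(2))
    show "(A <+>\<^bsub>R\<^esub> ?K) \<inter> (B <+>\<^bsub>R\<^esub> ?K) \<subseteq> I"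
    proof
      fix x assume "x \<in> (A <+>\<^bsub>R\<^esub> ?K) \<inter> (B <+>\<^bsub>R\<^esub> ?K)"
      then obtain a k b k' where x: "a \<in> A" "k \<in> ?K" "x = a \<oplus> k" "b \<in> B" "k' \<in> ?K" "x = b \<oplus> k'"
        by (auto simp: set_add_def')
      obtain u v where u: "u \<in> carrier R - P" "u \<otimes> k = \<zero>" and v: "v \<in> carrier R - P" "v \<otimes> k' = \<zero>"
        using ann x by blast
      have c: "a \<in> carrier R" "b \<in> carrier R" "k \<in> carrier R" "k' \<in> carrier R"
        "u \<in> carrier R" "v \<in> carrier R"
        using x AE BE ideal.Icarr[OF K] u v by auto
      \<comment> \<open>The factor u v kills both k and k', so it moves x into A and into B, hence
        into I; being outside P, it can be cancelled.\<close>
      have "(u \<otimes> v) \<otimes> x = v \<otimes> (u \<otimes> a) \<oplus> v \<otimes> (u \<otimes> k)"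
        unfolding x(3) using c by (simp add: r_distr m_ac)
      then have 1: "(u \<otimes> v) \<otimes> x \<in> A"
        using u(2) AE(2) x(1) c by simp
      have "(u \<otimes> v) \<otimes> x = u \<otimes> (v \<otimes> b) \<oplus> u \<otimes> (v \<otimes> k')"
        unfolding x(6) using c by (simp add: r_distr m_ac)
      then have 2: "(u \<otimes> v) \<otimes> x \<in> B"
        using v(2) BE(2) x(4) c by simp
      have "u \<otimes> v \<in> carrier R - P" using u v P.I_prime by auto
      then show "x \<in> I"
        using rad(3)[of "u \<otimes> v" x] 1 2 AB x(3) c by auto
    qed
  qed
  ultimately show "quasi_prime_ideal R I \<and> residual R M (ideal_smult R I M) \<subseteq> I" by blast
qed

end

theorem theorem2p14:
  fixes R :: "('a, 'm) ring_scheme" and M :: "('a, 'b, 'n) module_scheme"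
  assumes "module R M" and "\<one>\<^bsub>R\<^esub> \<noteq> \<zero>\<^bsub>R\<^esub>"
  shows "(principal_domain R \<and> fin_generated R M \<longrightarrow> quasi_primeful R M) \<and>
         (dedekind_domain R \<and> faithfully_flat R M \<longrightarrow> quasi_primeful R M) \<and>
         (laskerian_ring R \<and> locally_free R M \<longrightarrow> quasi_primeful R M)"
proof -
  interpret module R M by fact
  show ?thesis
    using quasi_primeful_principal quasi_primeful_faithfully_flat quasi_primeful_locally_free assms(2)
    by blast
qed

end
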